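(* Let $n\ge2$ and let $[r_-,r_+]$ be the support of the annular profile $\phi_A$ in $\mathbb{R}^n$. (i) (Location of the radii) For $n\ge3$, $$2\left(\sqrt{n-1}-\kappa\right)^2<r_-^2<2\left(\frac{n-1}{\sqrt{n-1}+\kappa}\right)^2,\qquad 2\left(\sqrt{n-1}+\kappa\right)^2<r_+^2<2\left(\frac{n-1}{\sqrt{n-1}-\kappa}\right)^2,$$ where $\kappa=1.1623\ldots$ is the first positive zero of the even solution of $Y''-2xY'+Y=0$ (normalized by $Y(0)=1$, $Y'(0)=0$). In particular, as $n\to\infty$, $$r_\pm=\sqrt{2(n-1)}\pm\sqrt2\,\kappa+O(n^{-1/2}).$$ When $n=2$, one still has $r_-^2<2(1+\kappa)^{-2}$ and $r_+^2>2(1+\kappa)^2$. (ii) (Width and product) For every $n\ge2$, $$r_+-r_-<\sqrt{14}\qquad\text{and}\qquad r_-\,r_+<2(n-1).$$ (iii) (Outward bias) For every $n\ge2$, with $\delta:=\frac12(r_+-r_-)$, $$\frac{\int_0^\delta s^4e^{-s^2/2}\,ds}{\int_0^\delta s^2e^{-s^2/2}\,ds}<\left(\frac{r_-+r_+}{2}\right)^2-2(n-1)<\delta^2 .$$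
   Context: For each $n\ge2$ there exist unique $0<r_-<r_+<\infty$ and a unique function $\phi=\phi_A$ (the annular profile), written as a function of $r=|y|$, with $\phi\in C^2((r_-,r_+))\cap C^1([r_-,r_+])$, such that $\phi>0$ on $(r_-,r_+)$, $\phi(r_\pm)=0$, $\phi'(r_-)=1$, $\phi'(r_+)=-1$, and $$\phi''+\left(\frac{n-1}{r}-\frac r2\right)\phi'+\frac12\phi=0\quad\text{on }(r_-,r_+).$$ Equivalently, $\phi_A(|y|)$, extended by $0$, is the unique radial solution of $\Delta\phi-\frac12y\cdot\nabla\phi+\frac12\phi=0$ in $\{\phi>0\}$, $|\nabla\phi|=1$ on $\partial\{\phi>0\}$, whose positivity set is an annulus centered at the origin. *)

theory Defs
  imports "HOL-Analysis.Analysis" "HOL-Library.Landau_Symbols"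
begin

(* The derivatives within the closed interval are one-sided at the endpoints;
   with the continuity of phi' this is C^1([rm, rp]).  Values of phi outside
   [rm, rp] are irrelevant. *)
definition annular_profile :: "nat \<Rightarrow> real \<Rightarrow> real \<Rightarrow> (real \<Rightarrow> real) \<Rightarrow> bool" where
  "annular_profile n rm rp \<phi> \<longleftrightarrow>
     0 < rm \<and> rm < rp \<and>
     (\<exists>\<phi>' \<phi>''.
        (\<forall>r\<in>{rm..rp}. (\<phi> has_real_derivative \<phi>' r) (at r within {rm..rp})) \<and>
        continuous_on {rm..rp} \<phi>' \<and>
        (\<forall>r\<in>{rm<..<rp}. (\<phi>' has_real_derivative \<phi>'' r) (at r)) \<and>
        continuous_on {rm<..<rp} \<phi>'' \<and>
        (\<forall>r\<in>{rm<..<rp}. \<phi> r > 0) \<and>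
        \<phi> rm = 0 \<and> \<phi> rp = 0 \<and> \<phi>' rm = 1 \<and> \<phi>' rp = -1 \<and>
        (\<forall>r\<in>{rm<..<rp}.
           \<phi>'' r + ((real n - 1) / r - r / 2) * \<phi>' r + (1 / 2) * \<phi> r = 0))"

definition even_hermite_solution :: "(real \<Rightarrow> real) \<Rightarrow> bool" where
  "even_hermite_solution Y \<longleftrightarrow>
     (\<forall>x. Y (- x) = Y x) \<and>
     (\<exists>Y' Y''.
        (\<forall>x. (Y has_real_derivative Y' x) (at x)) \<and>
        (\<forall>x. (Y' has_real_derivative Y'' x) (at x)) \<and>
        Y 0 = 1 \<and> Y' 0 = 0 \<and>
        (\<forall>x. Y'' x - 2 * x * Y' x + Y x = 0))"

definition first_positive_zero :: "(real \<Rightarrow> real) \<Rightarrow> real \<Rightarrow> bool" where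
  "first_positive_zero f k \<longleftrightarrow> 0 < k \<and> f k = 0 \<and> (\<forall>x. 0 < x \<and> x < k \<longrightarrow> f x \<noteq> 0)"

(* Well defined: the initial value problem has exactly one solution, and that
   solution has a positive zero. *)
definition kappa :: real ("\<kappa>") where
  "\<kappa> = (THE k. \<exists>Y. even_hermite_solution Y \<and> first_positive_zero Y k)"

end

(* Write N = n - 1 and b(r) = r/2 - N/r, so that the profile satisfies f'' = b f' - f/2.  Let c and
   d be the midpoint and half width of its support and D = c^2 - 2N.

   Since b(c-s) + b(c+s) has the sign of D - s^2, the Wronskian of the two mirror images f(c-s) and
   f(c+s) is controlled by D.  Both images vanish with slope of modulus 1 at s = d, so their quotient
   is 1 at s = 0 and at s = d; this forces 0 < D < d^2, f'(c) > 0 and f(c-s) <= f(c+s).  The upper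
   bound on D is r_- r_+ < 2N.

   As b(r) < r - sqrt(2N) away from r = sqrt(2N), and f' > 0 there, comparison with the even Hermite
   solution centred at sqrt(2N) gives the lower bounds for both radii; the upper bounds follow from
   the product.  A polynomial test function in the Rayleigh quotient bounds the width by sqrt 14.

   For the outward bias, f''' is decreasing, hence (f'(c-s) - f'(c+s))/s is nondecreasing.  Testing
   the equation of the odd part of f with the function s shows that D exceeds the mean of s^2 for a
   weight whose quotient by s^2 exp(-s^2/2) is increasing, and Chebyshev's inequality concludes. *)
theory Submission
  imports Defs
begin

section \<open>Annular profiles\<close>

text \<open>The two mirror images satisfy equations with different drifts. Multiplying their
  Wronskian by either one of the two mirrored weights leaves a single slope,
  \<open>g (c - s)\<close> or \<open>g (c + s)\<close>, in the derivative; the sign of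
  \<open>g c\<close> decides which of them is under control.

  The hard point is the monotonicity of f''', that is \<open>g3 \<le> 0\<close>. Left of the maximum
  of f the signs of the individual terms do not decide it. It takes a quantitative bound on how far
  \<open>rm\<close> lies below sqrt(2N), hence a decimal enclosure of \<kappa>, and separate
  estimates for N = 1, 2, 3 and for N >= 4.

  The width bound is an ingredient of the outward bias: the quotient of weights is increasing as
  long as s^2 < D + 4, and d^2 < 7/2 ensures this. Its own proof splits because the inverse-square
  term of the normal form, - N (N - 2) / (4 r^2), is repulsive or absent for N >= 2 but attractive
  for N = 1.\<close>

lemma nondecreasing_if_deriv_nonneg:
  fixes F F' :: "real \<Rightarrow> real"
  assumes "a \<le> b" "continuous_on {a..b} F"
    and der: "\<And>x. a < x \<Longrightarrow> x < b \<Longrightarrow> (F has_real_derivative F' x) (at x)"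
    and nonneg: "\<And>x. a < x \<Longrightarrow> x < b \<Longrightarrow> F' x \<ge> 0"
  shows "F a \<le> F b"
proof (cases "a = b")
  case False
  with assms(1) have "a < b" by simp
  with MVT[OF this assms(2)] der obtain l z where "a < z" "z < b" "DERIV F z :> l" "F b - F a = (b - a) * l"
    by (meson real_differentiable_def)
  with der[of z] nonneg[of z] have "l \<ge> 0" using DERIV_unique by blast
  with \<open>F b - F a = (b - a) * l\<close> \<open>a < b\<close> show ?thesis
    by (smt (verit) mult_nonneg_nonneg)
qed simp

lemma increasing_if_deriv_pos:
  fixes F F' :: "real \<Rightarrow> real"
  assumes "a < b" "continuous_on {a..b} F"
    and "\<And>x. a < x \<Longrightarrow> x < b \<Longrightarrow> (F has_real_derivative F' x) (at x)"
    and "\<And>x. a < x \<Longrightarrow> x < b \<Longrightarrow> F' x > 0"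
  shows "F a < F b"
  using DERIV_pos_imp_increasing_open[OF assms(1) _ assms(2)] assms(3,4) by blast

lemma decreasing_if_deriv_neg:
  fixes F F' :: "real \<Rightarrow> real"
  assumes "a < b" "continuous_on {a..b} F"
    and "\<And>x. a < x \<Longrightarrow> x < b \<Longrightarrow> (F has_real_derivative F' x) (at x)"
    and "\<And>x. a < x \<Longrightarrow> x < b \<Longrightarrow> F' x < 0"
  shows "F b < F a"
  using DERIV_neg_imp_decreasing_open[OF assms(1) _ assms(2)] assms(3,4) by blast

section \<open>The drift of the profile equation and its integrating factor\<close>

definition drift :: "real \<Rightarrow> real \<Rightarrow> real" where
  "drift N r = r / 2 - N / r"

text \<open>The radial density of exp(-|y|^2/4) in dimension N + 1. Its logarithmic derivative is
  \<open>- drift N\<close>, so it is the integrating factor of the profile equation.\<close>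

definition gauss_weight :: "real \<Rightarrow> real \<Rightarrow> real" where
  "gauss_weight N r = r powr N * exp (- (r^2) / 4)"

lemma gauss_weight_pos: "r > 0 \<Longrightarrow> gauss_weight N r > 0"
  by (simp add: gauss_weight_def)

lemma gauss_weight_deriv [derivative_intros]:
  assumes "(h has_real_derivative h') (at x)" "h x > 0"
  shows "((\<lambda>x. gauss_weight N (h x)) has_real_derivative - drift N (h x) * gauss_weight N (h x) * h') (at x)"
proof -
  have "((\<lambda>r. gauss_weight N r) has_real_derivative - drift N r * gauss_weight N r) (at r)" if "r > 0" for r
  proof -
    have "((\<lambda>r. r powr N * exp (- (r^2) / 4)) has_real_derivative
       N * r powr (N - 1) * exp (- (r^2) / 4) + r powr N * (exp (- (r^2) / 4) * (- (2 * r) / 4))) (at r)"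
      by (rule derivative_eq_intros refl | use that in simp)+
    moreover have "N * r powr (N - 1) * exp (- (r^2) / 4) + r powr N * (exp (- (r^2) / 4) * (- (2 * r) / 4))
       = - drift N r * gauss_weight N r"
      using that by (simp add: drift_def gauss_weight_def powr_diff field_simps)
    ultimately show ?thesis unfolding gauss_weight_def by simp
  qed
  from DERIV_chain2[OF this assms(1)] assms(2) show ?thesis by simp
qed

lemma continuous_on_gauss_weight [continuous_intros]:
  assumes "continuous_on S h" "\<And>x. x \<in> S \<Longrightarrow> h x > 0"
  shows "continuous_on S (\<lambda>x. gauss_weight N (h x))"
  unfolding gauss_weight_def using assms by (intro continuous_intros) (auto dest!: assms(2))

lemma drift_deriv [derivative_intros]:
  assumes "(h has_real_derivative h') (at x)" "h x \<noteq> 0"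
  shows "((\<lambda>x. drift N (h x)) has_real_derivative (1 / 2 + N / (h x)^2) * h') (at x)"
  unfolding drift_def using assms
  by (auto intro!: derivative_eq_intros simp: field_simps power2_eq_square)

lemma continuous_on_drift [continuous_intros]:
  assumes "continuous_on S h" "\<And>x. x \<in> S \<Longrightarrow> h x \<noteq> 0"
  shows "continuous_on S (\<lambda>x. drift N (h x))"
  unfolding drift_def using assms by (intro continuous_intros) auto

lemma drift_sum:
  assumes "\<bar>s\<bar> < c"
  shows "drift N (c - s) + drift N (c + s) = c * (c^2 - 2 * N - s^2) / (c^2 - s^2)"
proof -
  have nz: "c - s \<noteq> 0" "c + s \<noteq> 0" using assms by auto
  have eq: "c^2 - s^2 = (c - s) * (c + s)" by (simp add: power2_eq_square algebra_simps)
  have "drift N (c - s) + drift N (c + s) = c - N * (2 * c) / ((c - s) * (c + s))"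
    using nz unfolding drift_def by (simp add: divide_simps) (simp add: algebra_simps)
  also have "\<dots> = c * (c^2 - 2 * N - s^2) / ((c - s) * (c + s))"
    using nz by (simp add: divide_simps) (simp add: algebra_simps power2_eq_square)
  finally show ?thesis using eq by simp
qed

text \<open>\<open>g\<close> is f'; stating the equation as the derivative of \<open>g\<close>
  dispenses with a separate second derivative. \<open>N\<close> is a real parameter here, and
  integrality is added only in \<open>annular_nat\<close>.\<close>

locale annular =
  fixes N rm rp :: real and f g :: "real \<Rightarrow> real"
  assumes N_ge_1: "1 \<le> N"
    and rm_pos: "0 < rm" and rm_less_rp: "rm < rp"
    and f_deriv_within: "\<And>r. r \<in> {rm..rp} \<Longrightarrow> (f has_real_derivative g r) (at r within {rm..rp})"
    and g_cont: "continuous_on {rm..rp} g"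
    and g_deriv0: "\<And>r. rm < r \<Longrightarrow> r < rp \<Longrightarrow> (g has_real_derivative drift N r * g r - f r / 2) (at r)"
    and f_pos: "\<And>r. rm < r \<Longrightarrow> r < rp \<Longrightarrow> f r > 0"
    and f_rm: "f rm = 0" and f_rp: "f rp = 0" and g_rm: "g rm = 1" and g_rp: "g rp = -1"
begin

lemma f_deriv0: "rm < r \<Longrightarrow> r < rp \<Longrightarrow> (f has_real_derivative g r) (at r)"
  using f_deriv_within[of r] by (simp add: at_within_Icc_at)

lemma f_cont: "continuous_on {rm..rp} f"
  using f_deriv_within DERIV_continuous_on by blast

lemma f_deriv [derivative_intros]:
  assumes "(h has_real_derivative h') (at x)" "rm < h x" "h x < rp"
  shows "((\<lambda>x. f (h x)) has_real_derivative g (h x) * h') (at x)"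
  using DERIV_chain2[OF f_deriv0 assms(1)] assms by simp

lemma g_deriv [derivative_intros]:
  assumes "(h has_real_derivative h') (at x)" "rm < h x" "h x < rp"
  shows "((\<lambda>x. g (h x)) has_real_derivative (drift N (h x) * g (h x) - f (h x) / 2) * h') (at x)"
  using DERIV_chain2[OF g_deriv0 assms(1)] assms by simp

lemma f_cont_comp [continuous_intros]:
  assumes "continuous_on S h" "\<And>x. x \<in> S \<Longrightarrow> rm \<le> h x \<and> h x \<le> rp"
  shows "continuous_on S (\<lambda>x. f (h x))"
  using continuous_on_compose2[OF f_cont assms(1)] assms(2) by force

lemma g_cont_comp [continuous_intros]:
  assumes "continuous_on S h" "\<And>x. x \<in> S \<Longrightarrow> rm \<le> h x \<and> h x \<le> rp"
  shows "continuous_on S (\<lambda>x. g (h x))"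
  using continuous_on_compose2[OF g_cont assms(1)] assms(2) by force

lemma f_nonneg: "rm \<le> r \<Longrightarrow> r \<le> rp \<Longrightarrow> f r \<ge> 0"
  using f_pos[of r] f_rm f_rp by (cases "r = rm \<or> r = rp") auto

abbreviation "weight \<equiv> gauss_weight N"
abbreviation "b \<equiv> drift N"

text \<open>In divergence form the equation is (weight g)' = - weight f / 2. Hence \<open>g\<close>
  can change sign only once, from plus to minus.\<close>

lemma flux_decreasing:
  assumes "rm \<le> r" "r < r'" "r' \<le> rp"
  shows "weight r' * g r' < weight r * g r"
proof (rule decreasing_if_deriv_neg[where F = "\<lambda>r. weight r * g r" and F' = "\<lambda>r. - weight r * f r / 2"])
  show "continuous_on {r..r'} (\<lambda>r. weight r * g r)"
    using assms rm_pos by (intro continuous_intros) auto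
  fix x assume x: "r < x" "x < r'"
  then show "((\<lambda>r. weight r * g r) has_real_derivative - weight x * f x / 2) (at x)"
    using assms rm_pos by (auto intro!: derivative_eq_intros simp: algebra_simps)
  show "- weight x * f x / 2 < 0" using f_pos[of x] gauss_weight_pos[of x] x assms rm_pos by simp
qed (use assms in auto)

lemma g_pos_left: 
  assumes "rm \<le> r" "r < r'" "r' \<le> rp" "g r' \<ge> 0" shows "g r > 0"
  using flux_decreasing[OF assms(1-3)] gauss_weight_pos[of r N] gauss_weight_pos[of r' N] assms rm_pos
  by (smt (verit) mult_nonneg_nonneg mult_nonneg_nonpos)

lemma g_neg_right: 
  assumes "rm \<le> r" "r < r'" "r' \<le> rp" "g r \<le> 0" shows "g r' < 0"
  using g_pos_left[OF assms(1-3)] assms(4) by (meson not_less)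

end

section \<open>Comparison of the mirror images\<close>

context annular
begin

section \<open>Wronskian and quotient of the mirror images\<close>

definition "c = (rm + rp) / 2"
definition "d = (rp - rm) / 2"
definition "D = c^2 - 2 * N"

lemma d_pos: "d > 0" and c_minus_d: "c - d = rm" and c_plus_d: "c + d = rp" and d_less_c: "d < c"
  using rm_pos rm_less_rp by (auto simp: c_def d_def field_simps)

lemma rm_rp: "rm * rp = c^2 - d^2"
  unfolding c_def d_def by (simp add: power2_eq_square field_simps)

lemma mirror_in:
  assumes "0 \<le> s" "s \<le> d" shows "rm \<le> c - s" "c - s \<le> rp" "rm \<le> c + s" "c + s \<le> rp"
  using assms c_minus_d c_plus_d by auto

lemma mirror_in_open:
  assumes "0 \<le> s" "s < d" shows "rm < c - s" "c - s < rp" "rm < c + s" "c + s < rp"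
  using assms c_minus_d c_plus_d by auto

text \<open>For u(s) = f(c - s) and v(s) = f(c + s) this is u v' - u' v; the plus sign comes from u'
  = - g(c - s).\<close>

definition wronskian :: "real \<Rightarrow> real" where
  "wronskian s = g (c - s) * f (c + s) + f (c - s) * g (c + s)"

text \<open>The value at \<open>d\<close> is the limit of the quotient 0/0, determined by the
  boundary slopes 1 and -1.\<close>

definition ratio :: "real \<Rightarrow> real" where
  "ratio s = (if s = d then 1 else f (c - s) / f (c + s))"

lemma wronskian_d: "wronskian d = 0"
  by (simp add: wronskian_def c_minus_d c_plus_d f_rm f_rp)

lemma wronskian_cont: "continuous_on {0..d} wronskian"
  unfolding wronskian_def by (intro continuous_intros) (auto simp: mirror_in)

text \<open>This weight leaves only the slope \<open>g (c - s)\<close>, which is positive when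
  \<open>g c \<ge> 0\<close>. Its counterpart below leaves only \<open>g (c + s)\<close>, which is
  negative when \<open>g c \<le> 0\<close>.\<close>

lemma wronskian_deriv_right:
  assumes "0 < s" "s < d"
  shows "((\<lambda>s. wronskian s * weight (c + s)) has_real_derivative
    - (b (c - s) + b (c + s)) * g (c - s) * f (c + s) * weight (c + s)) (at s)"
  unfolding wronskian_def using assms mirror_in_open[of s] rm_pos
  by - ((rule derivative_eq_intros refl | simp)+, simp add: field_simps)

lemma wronskian_deriv_left:
  assumes "0 < s" "s < d"
  shows "((\<lambda>s. wronskian s * weight (c - s)) has_real_derivative
    (b (c - s) + b (c + s)) * f (c - s) * g (c + s) * weight (c - s)) (at s)"
  unfolding wronskian_def using assms mirror_in_open[of s] rm_pos
  by - ((rule derivative_eq_intros refl | simp)+, simp add: field_simps)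

lemma ratio_deriv:
  assumes "0 < s" "s < d"
  shows "(ratio has_real_derivative - wronskian s / (f (c + s))^2) (at s)"
proof -
  have "((\<lambda>s. f (c - s)) has_real_derivative - g (c - s)) (at s)"
    "((\<lambda>s. f (c + s)) has_real_derivative g (c + s)) (at s)"
    using assms mirror_in_open[of s] by (auto intro!: derivative_eq_intros)
  then have "((\<lambda>s. f (c - s) / f (c + s)) has_real_derivative 
     (- g (c - s) * f (c + s) - f (c - s) * g (c + s)) / (f (c + s) * f (c + s))) (at s)"
    by (rule DERIV_divide) (use assms mirror_in_open[of s] f_pos[of "c + s"] in auto)
  moreover have "- g (c - s) * f (c + s) - f (c - s) * g (c + s) = - wronskian s"
    by (simp add: wronskian_def)
  ultimately have "((\<lambda>s. f (c - s) / f (c + s)) has_real_derivative - wronskian s / (f (c + s))^2) (at s)"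
    by (simp only: power2_eq_square)
  then show ?thesis
    by (rule has_field_derivative_transform_within_open[where S = "{0<..<d}"])
      (use assms in \<open>auto simp: ratio_def\<close>)
qed

lemma ratio_0: "ratio 0 = 1" 
  using d_pos f_pos[of c] c_minus_d c_plus_d by (auto simp: ratio_def)

lemma ratio_d: "ratio d = 1" 
  by (auto simp: ratio_def)

lemma ratio_tendsto: "(ratio \<longlongrightarrow> 1) (at_left d)"
proof -
  have "((\<lambda>y. f y / (y - rm)) \<longlongrightarrow> 1) (at_right rm)"
    using f_deriv_within[of rm] rm_less_rp f_rm g_rm 
    by (simp add: has_field_derivative_iff at_within_Icc_at_right)
  moreover have "filterlim (\<lambda>s. c - s) (at_right rm) (at_left d)"
  proof -
    have "((\<lambda>s. c - s) \<longlongrightarrow> c - d) (at_left d)" by (intro tendsto_intros)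
    then have "filterlim (\<lambda>s. c - s) (at_right (c - d)) (at_left d)" unfolding filterlim_at
      by (auto simp: eventually_at_left_field intro!: exI[of _ "d - 1"])
    then show ?thesis by (simp only: c_minus_d)
  qed
  ultimately have l: "((\<lambda>s. f (c - s) / (c - s - rm)) \<longlongrightarrow> 1) (at_left d)"
    by (rule filterlim_compose)
  have "((\<lambda>y. f y / (y - rp)) \<longlongrightarrow> - 1) (at_left rp)"
    using f_deriv_within[of rp] rm_less_rp f_rp g_rp 
    by (simp add: has_field_derivative_iff at_within_Icc_at_left)
  moreover have "filterlim (\<lambda>s. c + s) (at_left rp) (at_left d)"
  proof -
    have "((\<lambda>s. c + s) \<longlongrightarrow> c + d) (at_left d)" by (intro tendsto_intros)
    then have "filterlim (\<lambda>s. c + s) (at_left (c + d)) (at_left d)" unfolding filterlim_at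
      by (auto simp: eventually_at_left_field intro!: exI[of _ "d - 1"])
    then show ?thesis by (simp only: c_plus_d)
  qed
  ultimately have r: "((\<lambda>s. f (c + s) / (c + s - rp)) \<longlongrightarrow> - 1) (at_left d)"
    by (rule filterlim_compose)
  have "((\<lambda>s. (f (c - s) / (c - s - rm)) / (- (f (c + s) / (c + s - rp)))) \<longlongrightarrow> 1 / (- (- 1))) (at_left d)"
    by (intro tendsto_intros l r) auto
  moreover have "eventually (\<lambda>s. (f (c - s) / (c - s - rm)) / (- (f (c + s) / (c + s - rp))) = ratio s) (at_left d)"
  proof -
    have "eventually (\<lambda>s. s \<in> {0<..<d}) (at_left d)"
      using eventually_at_left_real[OF d_pos] .
    then show ?thesis
    proof eventually_elim
      case (elim s)
      have eq: "c - s - rm = d - s" "c + s - rp = - (d - s)" using c_minus_d c_plus_d by auto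
      show ?case unfolding eq using elim by (simp add: ratio_def divide_simps, simp add: algebra_simps)
    qed
  qed
  ultimately show ?thesis using tendsto_cong by force
qed

lemma ratio_cont: "continuous_on {0..d} ratio"
  unfolding continuous_on_eq_continuous_within
proof
  fix s assume s: "s \<in> {0..d}"
  show "continuous (at s within {0..d}) ratio"
  proof (cases "s = d")
    case True
    then show ?thesis using ratio_tendsto d_pos
      by (simp add: continuous_within at_within_Icc_at_left ratio_d)
  next
    case False
    have "continuous_on {0..<d} (\<lambda>x. f (c - x) / f (c + x))"
    proof (intro continuous_on_divide f_cont_comp continuous_intros ballI)
      fix x assume "x \<in> {0..<d}"
      then show "f (c + x) \<noteq> 0" "rm \<le> c - x \<and> c - x \<le> rp" "rm \<le> c + x \<and> c + x \<le> rp"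
        using mirror_in_open[of x] f_pos[of "c + x"] by auto
    qed
    then have "continuous_on {0..<d} ratio"
      by (rule continuous_on_cong[THEN iffD1, rotated -1]) (auto simp: ratio_def)
    moreover have "at s within {0..<d} = at s within {0..d}"
      by (rule at_within_nhd[of s "{..<d}"]) (use s False in auto)
    moreover have "s \<in> {0..<d}" using s False by auto
    ultimately show ?thesis 
      unfolding continuous_on_eq_continuous_within continuous_within by metis
  qed
qed

text \<open>\<open>ratio\<close> is 1 at both ends and its derivative has the sign of
  \<open>- wronskian s\<close>, which therefore cannot be constant.\<close>

lemma wronskian_not_all_neg:
  assumes "\<And>s. 0 < s \<Longrightarrow> s < d \<Longrightarrow> wronskian s < 0" shows False
proof -
  have "ratio 0 < ratio d"
    by (rule increasing_if_deriv_pos[OF d_pos ratio_cont ratio_deriv])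
      (use assms f_pos mirror_in_open in \<open>auto intro!: divide_neg_pos zero_less_power\<close>)
  then show False by (simp add: ratio_0 ratio_d)
qed

lemma wronskian_not_all_pos:
  assumes "\<And>s. 0 < s \<Longrightarrow> s < d \<Longrightarrow> wronskian s > 0" shows False
proof -
  have "ratio d < ratio 0"
    by (rule decreasing_if_deriv_neg[OF d_pos ratio_cont ratio_deriv])
      (use assms f_pos mirror_in_open in \<open>auto intro!: divide_pos_pos zero_less_power\<close>)
  then show False by (simp add: ratio_0 ratio_d)
qed

lemma drift_sum_c: "0 \<le> s \<Longrightarrow> s < d \<Longrightarrow> b (c - s) + b (c + s) = c * (D - s^2) / (c^2 - s^2)"
  using drift_sum[of s c N] d_less_c by (simp add: D_def)

lemma drift_sum_sgn: "0 \<le> s \<Longrightarrow> s < d \<Longrightarrow> sgn (b (c - s) + b (c + s)) = sgn (D - s^2)"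
proof -
  assume s: "0 \<le> s" "s < d"
  then have "s^2 < c^2" using d_less_c by (intro power_strict_mono) auto
  then show ?thesis unfolding drift_sum_c[OF s] using s d_less_c by (auto simp: sgn_mult sgn_divide)
qed

lemma weight_mirror_cont: 
  "continuous_on {0..d} (\<lambda>s. weight (c + s))" "continuous_on {0..d} (\<lambda>s. weight (c - s))"
  using d_less_c d_pos by (auto intro!: continuous_intros)

lemma weight_mirror_pos: 
  assumes "0 \<le> s" "s \<le> d" shows "weight (c + s) > 0" "weight (c - s) > 0"
  using assms d_less_c by (auto intro!: gauss_weight_pos)

text \<open>A one-signed drift sum makes a suitably weighted Wronskian strictly monotone; as it
  vanishes at \<open>d\<close>, it is then one-signed itself. The factor \<open>\<sigma>\<close>
  treats both signs at once.\<close>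

lemma drift_sum_not_one_signed:
  assumes "\<sigma> = 1 \<or> \<sigma> = (-1::real)"
    and sg: "\<And>s. 0 < s \<Longrightarrow> s < d \<Longrightarrow> \<sigma> * (b (c - s) + b (c + s)) > 0"
  shows False
proof -
  have "\<sigma> * wronskian s > 0" if s: "0 < s" "s < d" for s
  proof (cases "g c \<ge> 0")
    case True
    have "\<sigma> * (wronskian d * weight (c + d)) < \<sigma> * (wronskian s * weight (c + s))"
    proof (rule decreasing_if_deriv_neg[OF s(2)])
      show "continuous_on {s..d} (\<lambda>s. \<sigma> * (wronskian s * weight (c + s)))"
        using s by (intro continuous_intros continuous_on_subset[OF wronskian_cont]
          continuous_on_subset[OF weight_mirror_cont(1)]) auto
      fix x assume x: "s < x" "x < d"
      with s show "((\<lambda>s. \<sigma> * (wronskian s * weight (c + s))) has_real_derivative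
        \<sigma> * (- (b (c - x) + b (c + x)) * g (c - x) * f (c + x) * weight (c + x))) (at x)"
        by (intro DERIV_cmult wronskian_deriv_right) auto
      have "g (c - x) > 0" 
        using g_pos_left[of "c - x" c] x s True mirror_in_open[of x] by auto
      then have "(\<sigma> * (b (c - x) + b (c + x))) * (g (c - x) * f (c + x) * weight (c + x)) > 0"
        using x s mirror_in_open[of x] by (intro mult_pos_pos sg f_pos weight_mirror_pos) auto
      then show "\<sigma> * (- (b (c - x) + b (c + x)) * g (c - x) * f (c + x) * weight (c + x)) < 0"
        by (simp add: algebra_simps)
    qed
    then have "0 < (\<sigma> * wronskian s) * weight (c + s)" by (simp add: wronskian_d mult.assoc)
    then show ?thesis using weight_mirror_pos[of s] s by (simp add: zero_less_mult_iff)
  next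
    case False
    have "\<sigma> * (wronskian d * weight (c - d)) < \<sigma> * (wronskian s * weight (c - s))"
    proof (rule decreasing_if_deriv_neg[OF s(2)])
      show "continuous_on {s..d} (\<lambda>s. \<sigma> * (wronskian s * weight (c - s)))"
        using s by (intro continuous_intros continuous_on_subset[OF wronskian_cont]
          continuous_on_subset[OF weight_mirror_cont(2)]) auto
      fix x assume x: "s < x" "x < d"
      with s show "((\<lambda>s. \<sigma> * (wronskian s * weight (c - s))) has_real_derivative
        \<sigma> * ((b (c - x) + b (c + x)) * f (c - x) * g (c + x) * weight (c - x))) (at x)"
        by (intro DERIV_cmult wronskian_deriv_left) auto
      have "g (c + x) < 0" 
        using g_neg_right[of c "c + x"] x s False mirror_in_open[of x] by auto
      then have "(\<sigma> * (b (c - x) + b (c + x))) * (- g (c + x) * f (c - x) * weight (c - x)) > 0"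
        using x s mirror_in_open[of x] by (intro mult_pos_pos sg f_pos weight_mirror_pos) auto
      then show "\<sigma> * ((b (c - x) + b (c + x)) * f (c - x) * g (c + x) * weight (c - x)) < 0"
        by (simp add: algebra_simps)
    qed
    then have "0 < (\<sigma> * wronskian s) * weight (c - s)" by (simp add: wronskian_d mult.assoc)
    then show ?thesis using weight_mirror_pos[of s] s by (simp add: zero_less_mult_iff)
  qed
  then show False using assms(1) wronskian_not_all_neg wronskian_not_all_pos by force
qed

section \<open>Sign of D, slope at the midpoint and ordering of the mirror images\<close>

lemma D_pos: "D > 0"
proof (rule ccontr)
  assume "\<not> D > 0"
  then have "-1 * (b (c - s) + b (c + s)) > 0" if "0 < s" "s < d" for s
  proof -
    have "\<not> s^2 < D" "D \<noteq> s^2" using \<open>\<not> D > 0\<close> that zero_less_power2[of s] by linarith+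
    then show ?thesis using drift_sum_sgn[of s] that by (auto simp: sgn_if split: if_splits)
  qed
  then show False using drift_sum_not_one_signed[of "-1"] by auto
qed

lemma D_less: "D < d^2"
proof (rule ccontr)
  assume "\<not> D < d^2"
  then have "1 * (b (c - s) + b (c + s)) > 0" if "0 < s" "s < d" for s
    using drift_sum_sgn[of s] that power_strict_mono[of s d 2] by (auto simp: sgn_if split: if_splits)
  then show False using drift_sum_not_one_signed[of "1"] by auto
qed

lemma sqrt_D: "0 < sqrt D" "sqrt D < d" 
  using D_pos D_less d_pos by (auto intro: real_less_lsqrt)

lemma drift_sum_pos: "0 \<le> s \<Longrightarrow> s < sqrt D \<Longrightarrow> b (c - s) + b (c + s) > 0"
  using drift_sum_sgn[of s] sqrt_D power_strict_mono[of s "sqrt D" 2] D_pos 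
  by (auto simp: sgn_if split: if_splits)

lemma drift_sum_neg: "sqrt D < s \<Longrightarrow> s < d \<Longrightarrow> b (c - s) + b (c + s) < 0"
  using drift_sum_sgn[of s] sqrt_D power_strict_mono[of "sqrt D" s 2] D_pos 
  by (auto simp: sgn_if split: if_splits)

text \<open>Beyond \<open>sqrt D\<close> the drift sum is negative, so the weighted Wronskian
  increases up to its zero at \<open>d\<close>.\<close>

lemma wronskian_neg_near_d:
  assumes s: "sqrt D \<le> s" "s < d" shows "wronskian s < 0"
proof -
  have s0: "0 < s" using sqrt_D s by linarith
  show ?thesis
proof (cases "g c \<ge> 0")
  case True
  have "wronskian s * weight (c + s) < wronskian d * weight (c + d)"
  proof (rule increasing_if_deriv_pos[OF s(2)])
    show "continuous_on {s..d} (\<lambda>s. wronskian s * weight (c + s))"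
      using s s0 by (intro continuous_intros continuous_on_subset[OF wronskian_cont]
        continuous_on_subset[OF weight_mirror_cont(1)]) auto
    fix x assume x: "s < x" "x < d"
    with s s0 show "((\<lambda>s. wronskian s * weight (c + s)) has_real_derivative
      (- (b (c - x) + b (c + x)) * g (c - x) * f (c + x) * weight (c + x))) (at x)"
      by (intro wronskian_deriv_right) auto
    show "- (b (c - x) + b (c + x)) * g (c - x) * f (c + x) * weight (c + x) > 0"
      using x s s0 True mirror_in_open[of x] drift_sum_neg[of x] g_pos_left[of "c - x" c]
      by (intro mult_pos_pos f_pos weight_mirror_pos) auto
  qed
  then show ?thesis using weight_mirror_pos[of s] s s0 by (simp add: wronskian_d mult_less_0_iff)
next
  case False
  have "wronskian s * weight (c - s) < wronskian d * weight (c - d)"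
  proof (rule increasing_if_deriv_pos[OF s(2)])
    show "continuous_on {s..d} (\<lambda>s. wronskian s * weight (c - s))"
      using s s0 by (intro continuous_intros continuous_on_subset[OF wronskian_cont]
        continuous_on_subset[OF weight_mirror_cont(2)]) auto
    fix x assume x: "s < x" "x < d"
    with s s0 show "((\<lambda>s. wronskian s * weight (c - s)) has_real_derivative
      (b (c - x) + b (c + x)) * f (c - x) * g (c + x) * weight (c - x)) (at x)"
      by (intro wronskian_deriv_left) auto
    have "- (b (c - x) + b (c + x)) * f (c - x) * - g (c + x) * weight (c - x) > 0"
      using x s s0 False mirror_in_open[of x] drift_sum_neg[of x] g_neg_right[of c "c + x"]
      by (intro mult_pos_pos f_pos weight_mirror_pos) auto
    then show "(b (c - x) + b (c + x)) * f (c - x) * g (c + x) * weight (c - x) > 0"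
      by (simp only: mult_minus_left mult_minus_right minus_minus)
  qed
  then show ?thesis using weight_mirror_pos[of s] s s0 by (simp add: wronskian_d mult_less_0_iff)
qed
qed

text \<open>If \<open>g c \<le> 0\<close>, the Wronskian starts at 2 f(c) g(c) <= 0 and its weighted
  version decreases until \<open>sqrt D\<close>; beyond that point it is negative anyway, so it
  would be negative throughout.\<close>

lemma g_c_pos: "g c > 0"
proof (rule ccontr)
  assume gc: "\<not> g c > 0"
  have "wronskian s < 0" if s: "0 < s" "s < d" for s
  proof (cases "sqrt D \<le> s")
    case True then show ?thesis using wronskian_neg_near_d s by simp
  next
    case False
    have "wronskian s * weight (c - s) < wronskian 0 * weight (c - 0)"
    proof (rule decreasing_if_deriv_neg[OF s(1)])
      show "continuous_on {0..s} (\<lambda>s. wronskian s * weight (c - s))"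
        using s by (intro continuous_intros continuous_on_subset[OF wronskian_cont]
          continuous_on_subset[OF weight_mirror_cont(2)]) auto
      fix x assume x: "0 < x" "x < s"
      with s show "((\<lambda>s. wronskian s * weight (c - s)) has_real_derivative
        (b (c - x) + b (c + x)) * f (c - x) * g (c + x) * weight (c - x)) (at x)"
        by (intro wronskian_deriv_left) auto
      have "(b (c - x) + b (c + x)) * f (c - x) * - g (c + x) * weight (c - x) > 0"
        using x s False gc mirror_in_open[of x] drift_sum_pos[of x] g_neg_right[of c "c + x"]
        by (intro mult_pos_pos f_pos weight_mirror_pos) auto
      then show "(b (c - x) + b (c + x)) * f (c - x) * g (c + x) * weight (c - x) < 0" by simp
    qed
    moreover have "wronskian 0 \<le> 0" 
      using gc f_pos[of c] mirror_in_open[of 0] d_pos by (auto simp: wronskian_def mult_nonpos_nonneg mult_nonneg_nonpos intro!: add_nonpos_nonpos)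
    ultimately show ?thesis using weight_mirror_pos[of s] weight_mirror_pos[of 0] s 
      by (smt (verit) mult_nonneg_nonneg mult_nonpos_nonneg)
  qed
  then show False using wronskian_not_all_neg by blast
qed

text \<open>The weighted Wronskian decreases before \<open>sqrt D\<close> and is negative
  afterwards, so it changes sign at most once, from plus to minus. Thus \<open>ratio\<close> first
  falls from 1 and then rises back to 1; a point is compared with whichever end lies on its monotone
  branch.\<close>

lemma ratio_le_1:
  assumes s: "0 < s" "s < d" shows "ratio s \<le> 1"
proof (cases "wronskian s < 0")
  case True
  have neg: "wronskian x < 0" if x: "s < x" "x < d" for x
  proof (cases "sqrt D \<le> x")
    case True then show ?thesis using wronskian_neg_near_d x by simp
  next
    case False
    have "wronskian x * weight (c + x) < wronskian s * weight (c + s)"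
    proof (rule decreasing_if_deriv_neg[OF x(1)])
      show "continuous_on {s..x} (\<lambda>s. wronskian s * weight (c + s))"
        using s x by (intro continuous_intros continuous_on_subset[OF wronskian_cont]
          continuous_on_subset[OF weight_mirror_cont(1)]) auto
      fix y assume y: "s < y" "y < x"
      with s x show "((\<lambda>s. wronskian s * weight (c + s)) has_real_derivative
        (- (b (c - y) + b (c + y)) * g (c - y) * f (c + y) * weight (c + y))) (at y)"
        by (intro wronskian_deriv_right) auto
      have "(b (c - y) + b (c + y)) * g (c - y) * f (c + y) * weight (c + y) > 0"
        using x y s False g_c_pos mirror_in_open[of y] drift_sum_pos[of y] g_pos_left[of "c - y" c]
        by (intro mult_pos_pos f_pos weight_mirror_pos) auto
      then show "- (b (c - y) + b (c + y)) * g (c - y) * f (c + y) * weight (c + y) < 0"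
        by (simp only: mult_minus_left neg_less_0_iff_less)
    qed
    moreover have "wronskian s * weight (c + s) < 0" 
      using True weight_mirror_pos[of s] s by (simp add: mult_less_0_iff)
    ultimately show ?thesis using weight_mirror_pos[of x] x s
      by (smt (verit) mult_nonneg_nonneg)
  qed
  have "ratio s < ratio d"
    by (rule increasing_if_deriv_pos[OF s(2) continuous_on_subset[OF ratio_cont] ratio_deriv])
      (use neg s f_pos mirror_in_open in \<open>auto intro!: divide_neg_pos zero_less_power\<close>)
  then show ?thesis by (simp add: ratio_d)
next
  case False
  have nonneg: "wronskian x \<ge> 0" if x: "0 < x" "x < s" for x
  proof -
    have "s < sqrt D" using False wronskian_neg_near_d[of s] s by fastforce
    have "wronskian s * weight (c + s) < wronskian x * weight (c + x)"
    proof (rule decreasing_if_deriv_neg[OF x(2)])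
      show "continuous_on {x..s} (\<lambda>s. wronskian s * weight (c + s))"
        using s x by (intro continuous_intros continuous_on_subset[OF wronskian_cont]
          continuous_on_subset[OF weight_mirror_cont(1)]) auto
      fix y assume y: "x < y" "y < s"
      with s x show "((\<lambda>s. wronskian s * weight (c + s)) has_real_derivative
        (- (b (c - y) + b (c + y)) * g (c - y) * f (c + y) * weight (c + y))) (at y)"
        by (intro wronskian_deriv_right) auto
      have "(b (c - y) + b (c + y)) * g (c - y) * f (c + y) * weight (c + y) > 0"
        using x y s \<open>s < sqrt D\<close> g_c_pos mirror_in_open[of y] drift_sum_pos[of y] g_pos_left[of "c - y" c]
        by (intro mult_pos_pos f_pos weight_mirror_pos) auto
      then show "- (b (c - y) + b (c + y)) * g (c - y) * f (c + y) * weight (c + y) < 0"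
        by (simp only: mult_minus_left neg_less_0_iff_less)
    qed
    moreover have "wronskian s * weight (c + s) \<ge> 0" 
      using False weight_mirror_pos[of s] s by (intro mult_nonneg_nonneg) auto
    ultimately show ?thesis using weight_mirror_pos[of x] x s
      by (smt (verit) mult_nonneg_nonneg mult_neg_pos)
  qed
  have "- ratio 0 \<le> - ratio s"
    by (rule nondecreasing_if_deriv_nonneg[OF less_imp_le[OF s(1)] _ DERIV_minus[OF ratio_deriv]])
      (use nonneg s f_pos mirror_in_open continuous_on_subset[OF ratio_cont] in \<open>auto intro!: divide_nonneg_nonneg continuous_intros\<close>)
  then show ?thesis by (simp add: ratio_0)
qed

lemma f_mirror_le: "0 \<le> s \<Longrightarrow> s \<le> d \<Longrightarrow> f (c - s) \<le> f (c + s)"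
  using ratio_le_1[of s] f_pos[of "c + s"] mirror_in_open[of s]
  by (cases "s = 0 \<or> s = d") (auto simp: ratio_def c_minus_d c_plus_d f_rm f_rp)

lemma rm_rp_less: "rm * rp < 2 * N"
  using D_less rm_rp by (simp add: D_def)

lemma sqrt_2N_less_c: "sqrt (2 * N) < c"
  using D_pos d_less_c d_pos by (intro real_less_lsqrt) (auto simp: D_def)

end

section \<open>The even Hermite solution\<close>

text \<open>The factor \<open>u\<close> restores the exponent lost by differentiation, so the
  differential equation can be checked coefficient by coefficient.\<close>

lemma diffs_equiv_shift:
  fixes c :: "nat \<Rightarrow> real"
  assumes "summable (\<lambda>n. diffs c n * u ^ n)"
  shows "(\<lambda>n. real n * c n * u ^ n) sums (u * (\<Sum>n. diffs c n * u ^ n))"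
proof -
  have "(\<lambda>n. u * (real n * c n * u ^ (n - Suc 0))) sums (u * (\<Sum>n. diffs c n * u ^ n))"
    by (rule sums_mult[OF diffs_equiv[OF assms]])
  moreover have "u * (real n * c n * u ^ (n - Suc 0)) = real n * c n * u ^ n" for n
    by (cases n) auto
  ultimately show ?thesis by simp
qed

text \<open>Coefficients in u = x^2, where the equation becomes 4 u P'' + (2 - 4 u) P' + P = 0; the
  series is Kummer's function M(-1/4, 1/2, u).\<close>

fun hermite_coeff :: "nat \<Rightarrow> real" where
  "hermite_coeff 0 = 1"
| "hermite_coeff (Suc k) = (4 * real k - 1) / ((2 * real k + 1) * (2 * real k + 2)) * hermite_coeff k"

text \<open>Negativity of all coefficients after the constant one makes the solution decrease on the
  half line and each nonempty partial sum an upper bound.\<close>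

lemma hermite_coeff_neg: "hermite_coeff (Suc k) < 0"
proof (induction k)
  case (Suc k)
  have "(4 * real (Suc k) - 1) / ((2 * real (Suc k) + 1) * (2 * real (Suc k) + 2)) > 0"
    by (intro divide_pos_pos) auto
  then show ?case using Suc mult_pos_neg by (metis hermite_coeff.simps(2))
qed simp

lemma hermite_coeff_bound: "\<bar>hermite_coeff k\<bar> \<le> 1 / fact k"
proof (induction k)
  case (Suc k)
  have "\<bar>4 * real k - 1\<bar> \<le> 2 * (2 * real k + 1)" by auto
  then have "\<bar>4 * real k - 1\<bar> / ((2 * real k + 1) * (2 * real k + 2)) 
      \<le> 2 * (2 * real k + 1) / ((2 * real k + 1) * (2 * real k + 2))"
    by (intro divide_right_mono) auto
  also have "\<dots> = 1 / real (Suc k)" by (simp add: divide_simps, simp add: algebra_simps)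
  finally have "\<bar>(4 * real k - 1) / ((2 * real k + 1) * (2 * real k + 2))\<bar> \<le> 1 / real (Suc k)"
    by (simp add: abs_divide abs_mult)
  then have "\<bar>hermite_coeff (Suc k)\<bar> \<le> 1 / real (Suc k) * (1 / fact k)"
    using Suc by (simp only: hermite_coeff.simps abs_mult, intro mult_mono) auto
  then show ?case by simp
qed simp

lemma hermite_coeff_summable: "summable (\<lambda>k. hermite_coeff k * u ^ k)"
proof (rule summable_comparison_test)
  show "summable (\<lambda>k. \<bar>u\<bar> ^ k / fact k)"
    using summable_exp[of "\<bar>u\<bar>"] by (simp add: field_simps)
  have "norm (hermite_coeff k * u ^ k) \<le> \<bar>u\<bar> ^ k / fact k" for k
    using mult_right_mono[OF hermite_coeff_bound, of "\<bar>u\<bar> ^ k" k] by (simp add: abs_mult power_abs)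
  then show "\<exists>N. \<forall>k\<ge>N. norm (hermite_coeff k * u ^ k) \<le> \<bar>u\<bar> ^ k / fact k" by blast
qed

lemma hermite_coeff_diffs_summable: 
  "summable (\<lambda>k. diffs hermite_coeff k * u ^ k)" 
  "summable (\<lambda>k. diffs (diffs hermite_coeff) k * u ^ k)"
  by (intro termdiff_converges_all hermite_coeff_summable)+

definition hermite_profile :: "real \<Rightarrow> real" where
  "hermite_profile u = (\<Sum>k. hermite_coeff k * u ^ k)"

definition hermite_profile' :: "real \<Rightarrow> real" where
  "hermite_profile' u = (\<Sum>k. diffs hermite_coeff k * u ^ k)"

definition hermite_profile'' :: "real \<Rightarrow> real" where
  "hermite_profile'' u = (\<Sum>k. diffs (diffs hermite_coeff) k * u ^ k)"

lemma hermite_profile_deriv: "(hermite_profile has_real_derivative hermite_profile' u) (at u)"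
  unfolding hermite_profile_def[abs_def] hermite_profile'_def
  by (rule termdiffs_strong_converges_everywhere) (rule hermite_coeff_summable)

lemma hermite_profile'_deriv: "(hermite_profile' has_real_derivative hermite_profile'' u) (at u)"
  unfolding hermite_profile'_def[abs_def] hermite_profile''_def
  by (rule termdiffs_strong_converges_everywhere) (rule hermite_coeff_diffs_summable)

lemma hermite_profile_ode:
  "4 * (u * hermite_profile'' u) + 2 * hermite_profile' u - 4 * (u * hermite_profile' u) + hermite_profile u = 0"
proof -
  let ?c = hermite_coeff
  have "(\<lambda>k. 4 * (real k * diffs ?c k * u ^ k) + 2 * (diffs ?c k * u ^ k)
      - 4 * (real k * ?c k * u ^ k) + ?c k * u ^ k)
    sums (4 * (u * hermite_profile'' u) + 2 * hermite_profile' u - 4 * (u * hermite_profile' u) + hermite_profile u)"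
    unfolding hermite_profile_def hermite_profile'_def hermite_profile''_def
    by (intro sums_add sums_diff sums_mult diffs_equiv_shift summable_sums
        hermite_coeff_summable hermite_coeff_diffs_summable)
  moreover have "4 * (real k * diffs ?c k * u ^ k) + 2 * (diffs ?c k * u ^ k)
      - 4 * (real k * ?c k * u ^ k) + ?c k * u ^ k = 0" for k
  proof -
    have "(2 * real k + 1) * (2 * real k + 2) * ?c (Suc k) = (4 * real k - 1) * ?c k"
    proof -
      have "(2 * real k + 1) * (2 * real k + 2) \<noteq> 0" by (smt (verit) mult_eq_0_iff of_nat_0_le_iff)
      then show ?thesis by simp
    qed
    then have "(4 * real k + 2) * diffs ?c k - (4 * real k - 1) * ?c k = 0"
      by (simp add: diffs_def algebra_simps)
    then have "((4 * real k + 2) * diffs ?c k - (4 * real k - 1) * ?c k) * u ^ k = 0" by simp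
    then show ?thesis by (simp add: algebra_simps)
  qed
  ultimately show ?thesis using sums_unique2 sums_zero by (metis (no_types, lifting) sums_cong)
qed

definition hermite :: "real \<Rightarrow> real" where
  "hermite x = hermite_profile (x^2)"

definition hermite' :: "real \<Rightarrow> real" where
  "hermite' x = 2 * x * hermite_profile' (x^2)"

lemma hermite_deriv0: "(hermite has_real_derivative hermite' x) (at x)"
  unfolding hermite_def[abs_def] hermite'_def
  by (rule DERIV_cong[OF DERIV_chain2[OF hermite_profile_deriv]]) (auto intro!: derivative_eq_intros)

lemma hermite'_deriv0: "(hermite' has_real_derivative 2 * x * hermite' x - hermite x) (at x)"
proof -
  have "((\<lambda>x. hermite_profile' (x^2)) has_real_derivative hermite_profile'' (x^2) * (2 * x)) (at x)"
    by (rule DERIV_chain2[OF hermite_profile'_deriv]) (auto intro!: derivative_eq_intros)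
  then have "(hermite' has_real_derivative 2 * hermite_profile' (x^2) + 2 * x * (hermite_profile'' (x^2) * (2 * x))) (at x)"
    unfolding hermite'_def[abs_def] by (auto intro!: derivative_eq_intros)
  moreover have "2 * hermite_profile' (x^2) + 2 * x * (hermite_profile'' (x^2) * (2 * x)) = 2 * x * hermite' x - hermite x"
    using hermite_profile_ode[of "x^2"] by (simp add: hermite'_def hermite_def power2_eq_square algebra_simps)
  ultimately show ?thesis by simp
qed

lemma hermite_0: "hermite 0 = 1" "hermite' 0 = 0"
  using powser_zero[of hermite_coeff] by (auto simp: hermite_def hermite'_def hermite_profile_def)

lemma even_hermite_solution_hermite: "even_hermite_solution hermite"
  unfolding even_hermite_solution_def
proof (intro conjI allI)
  show "hermite (- x) = hermite x" for x by (simp add: hermite_def)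
  show "\<exists>Y' Y''. (\<forall>x. (hermite has_real_derivative Y' x) (at x)) \<and>
     (\<forall>x. (Y' has_real_derivative Y'' x) (at x)) \<and> hermite 0 = 1 \<and> Y' 0 = 0 \<and>
     (\<forall>x. Y'' x - 2 * x * Y' x + hermite x = 0)"
    using hermite_deriv0 hermite'_deriv0 hermite_0
    by (intro exI[of _ hermite'] exI[of _ "\<lambda>x. 2 * x * hermite' x - hermite x"]) auto
qed

lemma hermite_profile'_neg: 
  assumes "u \<ge> 0" shows "hermite_profile' u < 0"
proof -
  have neg: "- (diffs hermite_coeff k * u ^ k) \<ge> 0" for k
    using hermite_coeff_neg[of k] assms 
    by (simp add: diffs_def mult_nonneg_nonpos mult_nonpos_nonneg del: hermite_coeff.simps)
  have "0 < suminf (\<lambda>k. - (diffs hermite_coeff k * u ^ k))"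
    by (rule suminf_pos2[of _ 0]) (use neg hermite_coeff_neg[of 0] hermite_coeff_diffs_summable(1)[of u, unfolded diffs_def] in \<open>auto simp: diffs_def intro!: summable_minus simp del: hermite_coeff.simps\<close>)
  then show ?thesis unfolding hermite_profile'_def 
    by (subst (asm) suminf_minus[OF hermite_coeff_diffs_summable(1)]) simp
qed

lemma hermite'_neg: "x > 0 \<Longrightarrow> hermite' x < 0"
  using hermite_profile'_neg[of "x^2"] by (simp add: hermite'_def mult_pos_neg)

lemma hermite_strict_decreasing: "0 \<le> x \<Longrightarrow> x < y \<Longrightarrow> hermite y < hermite x"
  by (rule DERIV_neg_imp_decreasing_open)
    (use hermite_deriv0 hermite'_neg in \<open>auto intro!: exI continuous_at_imp_continuous_on DERIV_isCont\<close>)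

section \<open>Decimal enclosure and uniqueness of the first zero\<close>

lemma hermite_profile_le:
  assumes "u \<ge> 0" shows "hermite_profile u \<le> (\<Sum>k<Suc m. hermite_coeff k * u ^ k)"
proof -
  have s: "summable (\<lambda>k. hermite_coeff (k + Suc m) * u ^ (k + Suc m))"
    by (rule summable_ignore_initial_segment[OF hermite_coeff_summable])
  have "0 \<le> (\<Sum>k. - (hermite_coeff (k + Suc m) * u ^ (k + Suc m)))"
    using assms less_imp_le[OF hermite_coeff_neg]
    by (intro suminf_nonneg summable_minus s)
      (simp del: hermite_coeff.simps, intro mult_nonpos_nonneg, simp_all del: hermite_coeff.simps)
  then have "(\<Sum>k. hermite_coeff (k + Suc m) * u ^ (k + Suc m)) \<le> 0"
    using suminf_minus[OF s] by simp
  then show ?thesis unfolding hermite_profile_def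
    by (subst suminf_split_initial_segment[OF hermite_coeff_summable, of _ "Suc m"]) simp
qed

text \<open>From index m on, the majorant u^k / k! at least halves at each step because 2 u <= m, so
  the tail is at most twice its first term.\<close>

lemma hermite_profile_ge:
  assumes "u \<ge> 0" "2 * u \<le> real m"
  shows "hermite_profile u \<ge> (\<Sum>k<m. hermite_coeff k * u ^ k) - 2 * u ^ m / fact m"
proof -
  have b: "norm (hermite_coeff (k + m) * u ^ (k + m)) \<le> u ^ m / fact m * (1 / 2) ^ k" for k
  proof -
    have "u ^ (k + m) / fact (k + m) \<le> u ^ m / fact m * (1 / 2) ^ k"
    proof (induction k)
      case (Suc k)
      have "u / real (Suc (k + m)) \<le> 1 / 2" using assms by (simp add: field_simps)
      then have "u ^ (k + m) / fact (k + m) * (u / real (Suc (k + m))) \<le> (u ^ m / fact m * (1 / 2) ^ k) * (1 / 2)"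
        using assms by (intro mult_mono Suc) auto
      then show ?case by (simp add: field_simps)
    qed simp
    moreover have "norm (hermite_coeff (k + m) * u ^ (k + m)) \<le> u ^ (k + m) / fact (k + m)"
      using mult_right_mono[OF hermite_coeff_bound, of "\<bar>u\<bar> ^ (k + m)" "k + m"] assms
      by (simp add: abs_mult power_abs)
    ultimately show ?thesis by linarith
  qed
  have g: "(\<lambda>k. u ^ m / fact m * (1 / 2) ^ k) sums (u ^ m / fact m * 2)"
    using sums_mult[OF geometric_sums[of "1 / 2 :: real"], of "u ^ m / fact m"] by simp
  have "norm (\<Sum>k. hermite_coeff (k + m) * u ^ (k + m)) \<le> (\<Sum>k. u ^ m / fact m * (1 / 2) ^ k)"
    by (rule norm_suminf_le[OF b sums_summable[OF g]])
  also have "\<dots> = 2 * u ^ m / fact m" using sums_unique[OF g] by (simp add: mult.commute)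
  finally show ?thesis unfolding hermite_profile_def
    by (subst suminf_split_initial_segment[OF hermite_coeff_summable, of _ m]) (simp add: abs_le_iff)
qed

lemma hermite_numeric: "hermite 1.1623 > 0" "hermite 1.1624 < 0"
proof -
  have "hermite_profile (1.1623^2) \<ge> (\<Sum>k<9. hermite_coeff k * (1.1623^2) ^ k) - 2 * (1.1623^2) ^ 9 / fact 9"
    by (rule hermite_profile_ge) (simp_all add: power2_eq_square)
  moreover have "(\<Sum>k<9. hermite_coeff k * (1.1623^2) ^ k) - 2 * (1.1623^2) ^ 9 / fact 9 > 0"
    by (simp add: lessThan_nat_numeral eval_nat_numeral)
  ultimately show "hermite 1.1623 > 0" unfolding hermite_def by linarith
  have "hermite_profile (1.1624^2) \<le> (\<Sum>k<Suc 7. hermite_coeff k * (1.1624^2) ^ k)"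
    by (rule hermite_profile_le) simp
  moreover have "(\<Sum>k<Suc 7. hermite_coeff k * (1.1624^2) ^ k) < 0"
    by (simp add: lessThan_nat_numeral eval_nat_numeral)
  ultimately show "hermite 1.1624 < 0" unfolding hermite_def by linarith
qed

text \<open>Two even solutions have vanishing Wronskian, so their quotient is constant up to a zero.\<close>

lemma even_hermite_solution_eq:
  assumes "even_hermite_solution Y" "even_hermite_solution Z" 
    and nz: "\<And>x. 0 \<le> x \<Longrightarrow> x \<le> k \<Longrightarrow> Z x \<noteq> 0" and "0 < k"
  shows "Y k = Z k"
proof -
  from assms(1) obtain Y' Y'' where Y: "\<And>x. (Y has_real_derivative Y' x) (at x)"
    "\<And>x. (Y' has_real_derivative Y'' x) (at x)" "Y 0 = 1" "Y' 0 = 0" "\<And>x. Y'' x - 2 * x * Y' x + Y x = 0"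
    unfolding even_hermite_solution_def by blast
  from assms(2) obtain Z' Z'' where Z: "\<And>x. (Z has_real_derivative Z' x) (at x)"
    "\<And>x. (Z' has_real_derivative Z'' x) (at x)" "Z 0 = 1" "Z' 0 = 0" "\<And>x. Z'' x - 2 * x * Z' x + Z x = 0"
    unfolding even_hermite_solution_def by blast
  have "((\<lambda>x. (Y x * Z' x - Y' x * Z x) * exp (- (x^2))) has_real_derivative 0) (at x)" for x
  proof -
    have e: "Y'' x = 2 * x * Y' x - Y x" "Z'' x = 2 * x * Z' x - Z x" using Y(5)[of x] Z(5)[of x] by linarith+
    show ?thesis
      by (rule derivative_eq_intros Y Z refl | simp)+ (simp add: e algebra_simps)
  qed
  then have "(Y x * Z' x - Y' x * Z x) * exp (- (x^2)) = (Y 0 * Z' 0 - Y' 0 * Z 0) * exp (- (0^2))" for x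
    by (intro DERIV_isconst_all) auto
  then have w: "Y x * Z' x - Y' x * Z x = 0" for x using Y Z by simp
  have "Y k / Z k = Y 0 / Z 0"
  proof (rule DERIV_isconst2[of 0 k])
    show "continuous_on {0..k} (\<lambda>x. Y x / Z x)"
      using nz by (intro continuous_intros continuous_at_imp_continuous_on ballI DERIV_isCont[OF Y(1)] DERIV_isCont[OF Z(1)]) auto
    fix x assume x: "0 < x" "x < k"
    have "((\<lambda>x. Y x / Z x) has_real_derivative (Y' x * Z x - Y x * Z' x) / (Z x * Z x)) (at x)"
      using nz[of x] x by (intro DERIV_divide Y Z) auto
    moreover have "Y' x * Z x - Y x * Z' x = 0" using w[of x] by linarith
    ultimately show "((\<lambda>x. Y x / Z x) has_real_derivative 0) (at x)" by simp
  qed (use \<open>0 < k\<close> in auto)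
  then show ?thesis using Y Z nz[of k] \<open>0 < k\<close> by (simp add: field_simps)
qed

lemma kappa_zero: "first_positive_zero hermite \<kappa>"
proof -
  have "\<exists>x\<ge>1.1623. x \<le> 1.1624 \<and> hermite x = 0"
    by (rule IVT2) (use hermite_numeric hermite_deriv0 DERIV_isCont in auto)
  then obtain k where k: "1.1623 \<le> k" "hermite k = 0" by auto
  have fz: "first_positive_zero hermite k"
    unfolding first_positive_zero_def
  proof (intro conjI allI impI k)
    show "0 < k" using k(1) by (rule less_le_trans[rotated]) simp
    show "hermite x \<noteq> 0" if "0 < x \<and> x < k" for x
      using hermite_strict_decreasing[of x k] that k(2) by simp
  qed
  \<comment> \<open>Up to the smaller of the two zeros the solution with the larger zero does not
    vanish, so it can serve as the divisor in the uniqueness argument; hence the two symmetric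
    cases.\<close>
  have "j = k" if Y: "even_hermite_solution Y" "first_positive_zero Y j" for Y j
  proof (rule linorder_cases[of j k])
    assume "j < k"
    have "Y j = hermite j"
    proof (rule even_hermite_solution_eq[OF Y(1) even_hermite_solution_hermite])
      fix x assume "0 \<le> x" "x \<le> j"
      then show "hermite x \<noteq> 0" using \<open>j < k\<close> fz hermite_0 unfolding first_positive_zero_def
        by (cases "x = 0") auto
    qed (use Y in \<open>auto simp: first_positive_zero_def\<close>)
    then show ?thesis using Y(2) fz \<open>j < k\<close> unfolding first_positive_zero_def by metis
  next
    assume "k < j"
    have "hermite k = Y k"
    proof (rule even_hermite_solution_eq[OF even_hermite_solution_hermite Y(1)])
      fix x assume "0 \<le> x" "x \<le> k"
      then show "Y x \<noteq> 0" using \<open>k < j\<close> Y unfolding first_positive_zero_def even_hermite_solution_def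
        by (cases "x = 0") auto
    qed (use k in auto)
    then show ?thesis using Y(2) fz \<open>k < j\<close> unfolding first_positive_zero_def by metis
  qed auto
  then have "\<kappa> = k" unfolding kappa_def
    using fz even_hermite_solution_hermite by (intro the_equality) blast+
  then show ?thesis using fz by simp
qed

lemma kappa_bounds: "1.1623 \<le> \<kappa>" "\<kappa> < 1.1624"
proof -
  have k: "0 < \<kappa>" "hermite \<kappa> = 0" using kappa_zero by (auto simp: first_positive_zero_def)
  show "1.1623 \<le> \<kappa>"
    using hermite_numeric(1) k hermite_strict_decreasing[of \<kappa> "1.1623"] by linarith
  show "\<kappa> < 1.1624"
  proof (rule ccontr)
    assume "\<not> ?thesis"
    then have "hermite \<kappa> \<le> hermite 1.1624"
      using hermite_strict_decreasing[of "1.1624" \<kappa>] by (cases "\<kappa> = 1.1624") (simp_all only:, auto)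
    then show False using hermite_numeric(2) k by linarith
  qed
qed

section \<open>Location of the radii\<close>

text \<open>With t = sqrt 2 x the equation becomes H'' = t H' - H / 2, which has the shape of the
  profile equation with drift t.\<close>

definition scaled_hermite :: "real \<Rightarrow> real" where
  "scaled_hermite t = hermite (t / sqrt 2)"

definition scaled_hermite' :: "real \<Rightarrow> real" where
  "scaled_hermite' t = hermite' (t / sqrt 2) / sqrt 2"

definition scaled_kappa :: real where
  "scaled_kappa = sqrt 2 * \<kappa>"

lemma scaled_hermite_deriv0: "(scaled_hermite has_real_derivative scaled_hermite' t) (at t)"
  unfolding scaled_hermite_def[abs_def] scaled_hermite'_def
  by (rule DERIV_cong[OF DERIV_chain2[OF hermite_deriv0 DERIV_cdivide[OF DERIV_ident]]]) simp

lemma scaled_hermite'_deriv0: 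
  "(scaled_hermite' has_real_derivative t * scaled_hermite' t - scaled_hermite t / 2) (at t)"
proof -
  have "((\<lambda>t. hermite' (t / sqrt 2)) has_real_derivative 
      (2 * (t / sqrt 2) * hermite' (t / sqrt 2) - hermite (t / sqrt 2)) * (1 / sqrt 2)) (at t)"
    by (rule DERIV_chain2[OF hermite'_deriv0 DERIV_cdivide[OF DERIV_ident]])
  from DERIV_cdivide[OF this, of "sqrt 2"] show ?thesis
    unfolding scaled_hermite'_def[abs_def] scaled_hermite_def
    by (rule DERIV_cong) (simp add: field_simps)
qed

lemma scaled_hermite_deriv [derivative_intros]:
  assumes "(h has_real_derivative h') (at x)"
  shows "((\<lambda>x. scaled_hermite (h x)) has_real_derivative scaled_hermite' (h x) * h') (at x)"
  by (rule DERIV_chain2[OF scaled_hermite_deriv0 assms])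

lemma scaled_hermite'_deriv [derivative_intros]:
  assumes "(h has_real_derivative h') (at x)"
  shows "((\<lambda>x. scaled_hermite' (h x)) has_real_derivative (h x * scaled_hermite' (h x) - scaled_hermite (h x) / 2) * h') (at x)"
  by (rule DERIV_chain2[OF scaled_hermite'_deriv0 assms])

lemma scaled_hermite_cont [continuous_intros]:
  "continuous_on S h \<Longrightarrow> continuous_on S (\<lambda>x. scaled_hermite (h x))"
  "continuous_on S h \<Longrightarrow> continuous_on S (\<lambda>x. scaled_hermite' (h x))"
  by (rule continuous_on_compose2[of UNIV]; 
    auto intro!: continuous_at_imp_continuous_on DERIV_isCont scaled_hermite_deriv0 scaled_hermite'_deriv0)+

lemma scaled_kappa_bounds: "16437 / 10000 < scaled_kappa" "scaled_kappa < 1644 / 1000" 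
proof -
  have s: "1.4142 < sqrt 2" "sqrt 2 < 1.41422"
    by (rule real_less_rsqrt real_less_lsqrt; simp add: power2_eq_square)+
  have "16437 / 10000 < 1.4142 * (1.1623::real)" by simp
  also have "\<dots> \<le> scaled_kappa" unfolding scaled_kappa_def 
    by (intro mult_mono kappa_bounds less_imp_le[OF s(1)]) auto
  finally show "16437 / 10000 < scaled_kappa" .
  have "scaled_kappa \<le> 1.41422 * (1.1624::real)" unfolding scaled_kappa_def 
    using kappa_bounds by (intro mult_mono less_imp_le[OF s(2)]) auto
  then show "scaled_kappa < 1644 / 1000" by simp
qed

lemma scaled_hermite_0: "scaled_hermite 0 = 1" "scaled_hermite' 0 = 0"
  by (auto simp: scaled_hermite_def scaled_hermite'_def hermite_0)

lemma scaled_hermite_zero: "scaled_hermite scaled_kappa = 0" "scaled_hermite (- scaled_kappa) = 0"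
  using kappa_zero by (auto simp: scaled_hermite_def scaled_kappa_def first_positive_zero_def hermite_def)

lemma scaled_hermite_nonneg:
  assumes "0 \<le> t" "t \<le> scaled_kappa" shows "scaled_hermite t \<ge> 0"
proof (cases "t = scaled_kappa")
  case False
  then have "t / sqrt 2 < \<kappa>" using assms by (simp add: scaled_kappa_def field_simps)
  then have "hermite \<kappa> < hermite (t / sqrt 2)" using assms by (intro hermite_strict_decreasing) auto
  then show ?thesis using kappa_zero by (simp add: scaled_hermite_def first_positive_zero_def)
qed (simp add: scaled_hermite_zero)

lemma scaled_hermite'_nonpos: "t \<ge> 0 \<Longrightarrow> scaled_hermite' t \<le> 0"
  using hermite'_neg[of "t / sqrt 2"] hermite_0
  by (cases "t = 0") (auto simp: scaled_hermite'_def field_simps)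

lemma scaled_hermite'_nonneg: "t \<le> 0 \<Longrightarrow> scaled_hermite' t \<ge> 0"
  using scaled_hermite'_nonpos[of "- t"] by (simp add: scaled_hermite'_def hermite'_def)

text \<open>The drift is concave, and r - sqrt(2N) is its tangent at its zero; the remainder is an
  explicit square.\<close>

lemma drift_tangent:
  assumes "0 \<le> N" "0 < r"
  shows "drift N r = (r - sqrt (2 * N)) - (r - sqrt (2 * N))^2 / (2 * r)"
proof -
  have "(r - sqrt (2 * N))^2 = r^2 + 2 * N - 2 * r * sqrt (2 * N)"
    using assms by (simp add: power2_diff)
  then show ?thesis using assms by (simp add: drift_def field_simps power2_eq_square)
qed

lemma drift_le_tangent:
  assumes "0 \<le> N" "0 < r" shows "drift N r \<le> r - sqrt (2 * N)"
  using drift_tangent[OF assms] assms by simp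

context annular
begin

section \<open>Comparison with the Hermite solution centred at the zero of the drift\<close>

definition "r0 = sqrt (2 * N)"

lemma r0_sq: "r0^2 = 2 * N" and r0_ge: "r0 \<ge> sqrt 2"
  using N_ge_1 by (auto simp: r0_def)

lemma rm_less_r0: "rm < r0"
proof -
  have "rm * rm < 2 * N" using rm_rp_less rm_less_rp rm_pos by (smt (verit) mult_left_mono)
  then show ?thesis unfolding r0_def by (intro real_less_rsqrt) (simp add: power2_eq_square)
qed

lemma r0_less_c: "r0 < c" using sqrt_2N_less_c by (simp add: r0_def)

lemma r0_less_rp: "r0 < rp" using r0_less_c c_plus_d d_pos by linarith

lemma g_r0_pos: "g r0 > 0"
  using g_pos_left[of r0 c] r0_less_c rm_less_r0 c_plus_d d_pos g_c_pos by simp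

lemma drift_le_shift: "0 < r \<Longrightarrow> b r \<le> r - r0"
  using drift_le_tangent N_ge_1 by (simp add: r0_def)

text \<open>The weighted Wronskian of the profile and the shifted Hermite solution. The weight
  absorbs the drift of the profile, so the derivative contains only the difference of the two
  drifts.\<close>

definition comparison :: "real \<Rightarrow> real" where
  "comparison r = (g r * scaled_hermite (r - r0) - f r * scaled_hermite' (r - r0)) * weight r"

lemma comparison_deriv:
  assumes "rm < r" "r < rp"
  shows "(comparison has_real_derivative 
    weight r * (f r * (scaled_hermite' (r - r0) * (b r - (r - r0))))) (at r)"
  unfolding comparison_def[abs_def] using assms rm_pos
  by - ((rule derivative_eq_intros refl | simp)+, simp add: field_simps)

lemma comparison_cont: "continuous_on {rm..rp} comparison"
  unfolding comparison_def[abs_def] using rm_pos by (intro continuous_intros) auto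

lemma comparison_r0: "comparison r0 > 0"
  using g_r0_pos gauss_weight_pos[of r0 N] rm_pos rm_less_r0 by (simp add: comparison_def scaled_hermite_0)

text \<open>Right of \<open>r0\<close> the Hermite slope and the drift difference are both
  nonpositive, so \<open>comparison\<close> stays above its positive value at \<open>r0\<close>. At
  \<open>rp\<close> it is minus the weight times the Hermite value, which is nonnegative up to the
  first zero.\<close>

lemma rp_lower: "r0 + scaled_kappa < rp"
proof (rule ccontr)
  assume "\<not> ?thesis"
  then have le: "rp - r0 \<le> scaled_kappa" by simp
  have "comparison r0 \<le> comparison rp"
  proof (rule nondecreasing_if_deriv_nonneg[where F = comparison])
    show "continuous_on {r0..rp} comparison"
      using rm_less_r0 by (intro continuous_on_subset[OF comparison_cont]) auto
    fix r assume r: "r0 < r" "r < rp"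
    then show "(comparison has_real_derivative 
        weight r * (f r * (scaled_hermite' (r - r0) * (b r - (r - r0))))) (at r)"
      using rm_less_r0 by (intro comparison_deriv) auto
    show "0 \<le> weight r * (f r * (scaled_hermite' (r - r0) * (b r - (r - r0))))"
      using r rm_less_r0 rm_pos f_pos[of r] gauss_weight_pos[of r N] drift_le_shift[of r] 
      by (intro mult_nonneg_nonneg mult_nonpos_nonpos scaled_hermite'_nonpos) auto
  qed (use r0_less_rp in simp)
  moreover have "comparison rp \<le> 0"
    using scaled_hermite_nonneg[of "rp - r0"] le r0_less_rp gauss_weight_pos[of rp N] rm_pos rm_less_rp
    by (simp add: comparison_def f_rp g_rp)
  ultimately show False using comparison_r0 by simp
qed

text \<open>Left of \<open>r0\<close> the Hermite slope changes sign, so \<open>comparison\<close>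
  grows to the left. It is evaluated at the Hermite zero, assumed to lie in the support, where only
  \<open>- f\<close> times a nonnegative slope remains.\<close>

lemma rm_lower: "r0 - scaled_kappa < rm"
proof (rule ccontr)
  assume "\<not> ?thesis"
  then have le: "rm \<le> r0 - scaled_kappa" by simp
  have a: "0 < scaled_kappa" using scaled_kappa_bounds by simp
  have "- comparison (r0 - scaled_kappa) \<le> - comparison r0"
  proof (rule nondecreasing_if_deriv_nonneg[where F = "\<lambda>r. - comparison r"])
    show "continuous_on {r0 - scaled_kappa..r0} (\<lambda>r. - comparison r)"
      using le r0_less_rp by (intro continuous_intros continuous_on_subset[OF comparison_cont]) auto
    fix r assume r: "r0 - scaled_kappa < r" "r < r0"
    then show "((\<lambda>r. - comparison r) has_real_derivative 
        - (weight r * (f r * (scaled_hermite' (r - r0) * (b r - (r - r0)))))) (at r)"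
      using le r0_less_rp by (intro DERIV_minus comparison_deriv) auto
    have "0 \<le> weight r * (f r * (scaled_hermite' (r - r0) * ((r - r0) - b r)))"
      using r le rm_pos r0_less_rp f_pos[of r] gauss_weight_pos[of r N] drift_le_shift[of r] 
      by (intro mult_nonneg_nonneg scaled_hermite'_nonneg) auto
    then show "0 \<le> - (weight r * (f r * (scaled_hermite' (r - r0) * (b r - (r - r0)))))"
      by (simp add: algebra_simps)
  qed (use a in simp)
  moreover have "comparison (r0 - scaled_kappa) \<le> 0"
    using scaled_hermite'_nonneg[of "- scaled_kappa"] f_nonneg[of "r0 - scaled_kappa"] le r0_less_rp a 
      gauss_weight_pos[of "r0 - scaled_kappa" N] rm_pos
    by (auto simp: comparison_def scaled_hermite_zero intro!: mult_nonpos_nonneg)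
  ultimately show False using comparison_r0 by simp
qed

lemma rm_upper: "rm < r0^2 / (r0 + scaled_kappa)"
proof -
  have p: "r0 + scaled_kappa > 0" using scaled_kappa_bounds rm_less_r0 rm_pos by linarith
  have "rm * (r0 + scaled_kappa) < rm * rp" using rp_lower rm_pos by simp
  also have "\<dots> < r0^2" using rm_rp_less r0_sq by simp
  finally show ?thesis using p by (simp add: pos_less_divide_eq)
qed

lemma rp_upper: 
  assumes "scaled_kappa < r0" shows "rp < r0^2 / (r0 - scaled_kappa)"
proof -
  have "(r0 - scaled_kappa) * rp < rm * rp" using rm_lower rm_pos rm_less_rp by simp
  also have "\<dots> < r0^2" using rm_rp_less r0_sq by simp
  finally show ?thesis using assms by (simp add: pos_less_divide_eq mult.commute)
qed

end

section \<open>Width of the annulus\<close>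

context annular
begin

text \<open>Liouville normal form: v = sqrt(weight) f satisfies v'' + potential v = 0. The function
  \<open>log_slope\<close> below is v'/v, hence its Riccati equation.\<close>

definition potential :: "real \<Rightarrow> real" where
  "potential r = 3 / 4 + N / 4 - r^2 / 16 - N * (N - 2) / (4 * r^2)"

definition slope :: "real \<Rightarrow> real" where
  "slope r = g r / f r"

lemma slope_deriv0:
  assumes "rm < r" "r < rp"
  shows "(slope has_real_derivative b r * slope r - 1 / 2 - (slope r)^2) (at r)"
proof -
  have fn: "f r \<noteq> 0" using f_pos[OF assms] by simp
  have "(slope has_real_derivative 
      ((b r * g r - f r / 2) * f r - g r * g r) / (f r * f r)) (at r)"
    unfolding slope_def[abs_def] by (rule DERIV_divide[OF g_deriv0 f_deriv0]) (use assms fn in auto)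
  moreover have "((b r * g r - f r / 2) * f r - g r * g r) / (f r * f r) 
      = b r * slope r - 1 / 2 - (slope r)^2"
    using fn by (simp add: slope_def field_simps power2_eq_square)
  ultimately show ?thesis by simp
qed

definition log_slope :: "real \<Rightarrow> real" where
  "log_slope r = slope r - b r / 2"

lemma log_slope_deriv0:
  assumes "rm < r" "r < rp"
  shows "(log_slope has_real_derivative - potential r - (log_slope r)^2) (at r)"
proof -
  have rn: "r \<noteq> 0" using assms rm_pos by auto
  define q where "q = 1 / r^2"
  have "((\<lambda>r. b r / 2) has_real_derivative (1 / 2 + N * q) / 2) (at r)"
    using rn by (auto intro!: derivative_eq_intros simp: q_def)
  then have der: "(log_slope has_real_derivative 
      (b r * slope r - 1 / 2 - (slope r)^2) - (1 / 2 + N * q) / 2) (at r)"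
    unfolding log_slope_def[abs_def] by (rule DERIV_diff[OF slope_deriv0[OF assms]])
  have "(b r)^2 = r^2 / 4 - N + N * N * q"
    using rn by (simp add: drift_def power2_diff power_divide q_def power2_eq_square[of N]) 
  moreover have "potential r = 3 / 4 + N / 4 - r^2 / 16 - N * (N - 2) / 4 * q"
    by (simp add: potential_def q_def)
  moreover have "(log_slope r)^2 = (slope r)^2 - b r * slope r + (b r)^2 / 4"
    by (simp add: log_slope_def power2_diff power_divide)
  ultimately have "(b r * slope r - 1 / 2 - (slope r)^2) - (1 / 2 + N * q) / 2 = - potential r - (log_slope r)^2"
    by (simp add: field_simps)
  with der show ?thesis by (simp only:)
qed

lemma log_slope_deriv [derivative_intros]:
  assumes "(h has_real_derivative h') (at x)" "rm < h x" "h x < rp"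
  shows "((\<lambda>x. log_slope (h x)) has_real_derivative (- potential (h x) - (log_slope (h x))^2) * h') (at x)"
  using DERIV_chain2[OF log_slope_deriv0 assms(1)] assms by simp

text \<open>Picone's identity, folded about the centre of the test interval so that odd parts cancel.\<close>

lemma picone_folded:
  fixes \<psi> \<psi>' G G' :: "real \<Rightarrow> real"
  assumes e: "0 < e" "rm < m - e" "m + e < rp"
    and psi: "\<And>s. (\<psi> has_real_derivative \<psi>' s) (at s)" "\<psi> e = 0" "\<And>s. \<psi> (- s) = \<psi> s"
    and G: "\<And>s. (G has_real_derivative G' s) (at s)"
    and le: "\<And>s. 0 < s \<Longrightarrow> s < e \<Longrightarrow>
      2 * (\<psi>' s)^2 - (potential (m + s) + potential (m - s)) * (\<psi> s)^2 \<le> G' s"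
  shows "G 0 \<le> G e"
proof -
  define H where "H s = G s - (\<psi> s)^2 * (log_slope (m + s) - log_slope (m - s))" for s
  have der: "(H has_real_derivative G' s - (2 * \<psi> s * \<psi>' s * (log_slope (m + s) - log_slope (m - s))
      - (\<psi> s)^2 * (potential (m + s) + (log_slope (m + s))^2 + potential (m - s) + (log_slope (m - s))^2))) (at s)"
    if "0 \<le> s" "s \<le> e" for s
    unfolding H_def[abs_def] using that e
    by - ((rule derivative_eq_intros G psi(1) refl | simp)+, simp add: algebra_simps)
  have "H 0 \<le> H e"
  proof (rule nondecreasing_if_deriv_nonneg[where F = H])
    show "continuous_on {0..e} H"
      by (intro continuous_at_imp_continuous_on ballI DERIV_isCont[OF der]) auto
    fix s assume s: "0 < s" "s < e"
    show "(H has_real_derivative G' s - (2 * \<psi> s * \<psi>' s * (log_slope (m + s) - log_slope (m - s))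
      - (\<psi> s)^2 * (potential (m + s) + (log_slope (m + s))^2 + potential (m - s) + (log_slope (m - s))^2))) (at s)"
      using der[of s] s by simp
    \<comment> \<open>One completed square for each half of the interval; the second sign is
      reversed because s runs to the left there.\<close>
    have "0 \<le> (\<psi>' s - \<psi> s * log_slope (m + s))^2 + (\<psi>' s + \<psi> s * log_slope (m - s))^2" by simp
    then show "0 \<le> G' s - (2 * \<psi> s * \<psi>' s * (log_slope (m + s) - log_slope (m - s))
      - (\<psi> s)^2 * (potential (m + s) + (log_slope (m + s))^2 + potential (m - s) + (log_slope (m - s))^2))"
      using le[OF s] by (simp add: power2_eq_square algebra_simps)
  qed (use e in simp)
  then show ?thesis using psi(2) by (simp add: H_def)
qed

text \<open>Only the Gaussian factor is removed here: for N = 1 the function v = exp(-r^2/8) f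
  satisfies (r v')' + r (1 - r^2/16) v = 0, and this is r v'/v.\<close>

definition log_slope1 :: "real \<Rightarrow> real" where
  "log_slope1 r = r * (slope r - r / 4)"

lemma log_slope1_deriv0:
  assumes "rm < r" "r < rp" "N = 1"
  shows "(log_slope1 has_real_derivative - r * (1 - r^2 / 16) - (log_slope1 r)^2 / r) (at r)"
proof -
  have rn: "r \<noteq> 0" using assms rm_pos by auto
  have der: "(log_slope1 has_real_derivative 
      1 * (slope r - r / 4) + (b r * slope r - 1 / 2 - (slope r)^2 - 1 / 4) * r) (at r)"
    unfolding log_slope1_def[abs_def] 
    by (rule DERIV_mult DERIV_diff DERIV_ident DERIV_cdivide slope_deriv0 assms)+
  have "(log_slope1 r)^2 / r = r * (slope r - r / 4)^2"
    using rn by (simp add: log_slope1_def power2_eq_square)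
  also have "\<dots> = (slope r)^2 * r - r^2 * slope r / 2 + r^3 / 16"
    by (simp add: power2_eq_square power3_eq_cube algebra_simps)
  finally have "(log_slope1 r)^2 / r = (slope r)^2 * r - r^2 * slope r / 2 + r^3 / 16" .
  moreover have "b r * slope r * r = r^2 * slope r / 2 - slope r" 
    using rn assms(3) by (simp add: drift_def field_simps power2_eq_square)
  moreover have "1 * (slope r - r / 4) + (b r * slope r - 1 / 2 - (slope r)^2 - 1 / 4) * r
      = slope r - r + b r * slope r * r - (slope r)^2 * r"
    by (simp add: algebra_simps)
  moreover have "- r * (1 - r^2 / 16) = - r + r^3 / 16"
    by (simp add: power2_eq_square power3_eq_cube algebra_simps)
  ultimately have "1 * (slope r - r / 4) + (b r * slope r - 1 / 2 - (slope r)^2 - 1 / 4) * r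
      = - r * (1 - r^2 / 16) - (log_slope1 r)^2 / r"
    by linarith
  with der show ?thesis by (simp only:)
qed

text \<open>In dimension two the ground state is strongly skewed; a test function in the
  weight \<open>r\<close> makes the Rayleigh quotient polynomial.\<close>

lemma picone_planar:
  fixes \<psi> \<psi>' G G' :: "real \<Rightarrow> real"
  assumes N1: "N = 1" and e: "0 < e" "rm < m - e" "m + e < rp"
    and psi: "\<And>s. (\<psi> has_real_derivative \<psi>' s) (at s)" "\<psi> e = 0" "\<psi> (- e) = 0"
    and G: "\<And>s. (G has_real_derivative 
      (m + s) * (\<psi>' s)^2 - (m + s) * (1 - (m + s)^2 / 16) * (\<psi> s)^2) (at s)"
  shows "G (- e) \<le> G e"
proof -
  define H where "H s = G s - (\<psi> s)^2 * log_slope1 (m + s)" for s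
  have dl: "((\<lambda>s. log_slope1 (m + s)) has_real_derivative 
      - (m + s) * (1 - (m + s)^2 / 16) - (log_slope1 (m + s))^2 / (m + s)) (at s)"
    if "- e \<le> s" "s \<le> e" for s
  proof -
    have "(log_slope1 has_real_derivative - (m + s) * (1 - (m + s)^2 / 16) - (log_slope1 (m + s))^2 / (m + s)) (at (m + s))"
      using that e N1 by (intro log_slope1_deriv0) auto
    moreover have "((\<lambda>s. m + s) has_real_derivative 1) (at s)" by (auto intro!: derivative_eq_intros)
    ultimately show ?thesis
      using DERIV_chain2[where f = log_slope1 and g = "\<lambda>s. m + s"] by fastforce
  qed
  have der: "(H has_real_derivative (m + s) * (\<psi>' s)^2 
      - 2 * \<psi> s * \<psi>' s * log_slope1 (m + s) + (\<psi> s)^2 * ((log_slope1 (m + s))^2 / (m + s))) (at s)"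
    if "- e \<le> s" "s \<le> e" for s
    unfolding H_def[abs_def] 
    by ((rule derivative_eq_intros G psi(1) dl[OF that] refl | simp)+, simp add: algebra_simps add_divide_distrib diff_divide_distrib)
  have "H (- e) \<le> H e"
  proof (rule nondecreasing_if_deriv_nonneg[where F = H])
    show "continuous_on {-e..e} H"
      by (intro continuous_at_imp_continuous_on ballI DERIV_isCont[OF der]) auto
    fix s assume s: "- e < s" "s < e"
    show "(H has_real_derivative (m + s) * (\<psi>' s)^2 
      - 2 * \<psi> s * \<psi>' s * log_slope1 (m + s) + (\<psi> s)^2 * ((log_slope1 (m + s))^2 / (m + s))) (at s)"
      using der[of s] s by simp
    have ms: "m + s > 0" using s e rm_pos by linarith
    have "0 \<le> ((m + s) * \<psi>' s - \<psi> s * log_slope1 (m + s))^2 / (m + s)" using ms by simp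
    also have "\<dots> = (m + s) * (\<psi>' s)^2 
      - 2 * \<psi> s * \<psi>' s * log_slope1 (m + s) + (\<psi> s)^2 * ((log_slope1 (m + s))^2 / (m + s))"
      using ms by (simp add: power2_eq_square field_simps)
    finally show "0 \<le> (m + s) * (\<psi>' s)^2 
      - 2 * \<psi> s * \<psi>' s * log_slope1 (m + s) + (\<psi> s)^2 * ((log_slope1 (m + s))^2 / (m + s))" .
  qed (use e in simp)
  then show ?thesis using psi by (simp add: H_def)
qed

text \<open>The half width \<open>187 / 100\<close> lies just below \<open>sqrt (7 / 2)\<close>, so that the test interval stays inside the support.\<close>

lemma no_wide_annulus_planar:
  assumes N1: "N = 1" and m: "rm < m - 187 / 100" "m + 187 / 100 < rp" "m^2 < 11 / 2"
  shows False
proof -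
  \<comment> \<open>\<open>34969 / 10000\<close> is the square of 187/100, so the bump vanishes at
    both ends; the linear factor tilts it towards the inner boundary.\<close>
  define \<psi> where "\<psi> s = (34969 / 10000 - s^2) * (1 - 7 / 20 * s)" for s :: real
  define \<psi>' where "\<psi>' s = (- 2 * s) * (1 - 7 / 20 * s) + (34969 / 10000 - s^2) * (- 7 / 20)" for s :: real
  \<comment> \<open>\<open>A0\<close>, \<open>A1\<close> are antiderivatives of \<open>s^i * (\<psi>' s)^2\<close>, and \<open>B0\<close> to \<open>B3\<close> of \<open>s^i * (\<psi> s)^2\<close>\<close>
  define A0 where "A0 s = 59918717089 / 40000000000 * s^1 + 244783 / 100000 * s^2 + 2859557 / 6000000 * s^3 - 21 / 20 * s^4 + 441 / 2000 * s^5" for s :: real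
  define A1 where "A1 s = 59918717089 / 80000000000 * s^2 + 244783 / 150000 * s^3 + 2859557 / 8000000 * s^4 - 21 / 25 * s^5 + 147 / 800 * s^6" for s :: real
  define B0 where "B0 s = 1222830961 / 100000000 * s^1 - 8559816727 / 2000000000 * s^2 - 219833282911 / 120000000000 * s^3 + 244783 / 200000 * s^4 + 286519 / 10000000 * s^5 - 7 / 60 * s^6 + 7 / 400 * s^7" for s :: real
  define B1 where "B1 s = 1222830961 / 200000000 * s^2 - 8559816727 / 3000000000 * s^3 - 219833282911 / 160000000000 * s^4 + 244783 / 250000 * s^5 + 286519 / 12000000 * s^6 - 1 / 10 * s^7 + 49 / 3200 * s^8" for s :: real
  define B2 where "B2 s = 1222830961 / 300000000 * s^3 - 8559816727 / 4000000000 * s^4 - 219833282911 / 200000000000 * s^5 + 244783 / 300000 * s^6 + 286519 / 14000000 * s^7 - 7 / 80 * s^8 + 49 / 3600 * s^9" for s :: real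
  define B3 where "B3 s = 1222830961 / 400000000 * s^4 - 8559816727 / 5000000000 * s^5 - 219833282911 / 240000000000 * s^6 + 34969 / 50000 * s^7 + 286519 / 16000000 * s^8 - 7 / 90 * s^9 + 49 / 4000 * s^10" for s :: real
  define G where "G s = m * A0 s + A1 s - m * B0 s - B1 s 
    + 1 / 16 * (m^3 * B0 s + 3 * m^2 * B1 s + 3 * m * B2 s + B3 s)" for s
  have d: "(A0 has_real_derivative (\<psi>' s)^2) (at s)" "(A1 has_real_derivative s * (\<psi>' s)^2) (at s)"
    "(B0 has_real_derivative (\<psi> s)^2) (at s)" "(B1 has_real_derivative s * (\<psi> s)^2) (at s)"
    "(B2 has_real_derivative s^2 * (\<psi> s)^2) (at s)" "(B3 has_real_derivative s^3 * (\<psi> s)^2) (at s)" for s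
    unfolding A0_def[abs_def] A1_def[abs_def] B0_def[abs_def] B1_def[abs_def] B2_def[abs_def] B3_def[abs_def]
      \<psi>_def \<psi>'_def
    by ((rule derivative_eq_intros refl)+, simp add: field_simps power2_eq_square power3_eq_cube eval_nat_numeral)+
  have "G (- (187 / 100)) \<le> G (187 / 100)"
  proof (rule picone_planar[OF N1 _ m(1,2), of \<psi> \<psi>' G])
    show "(\<psi> has_real_derivative \<psi>' s) (at s)" for s
      unfolding \<psi>_def[abs_def] \<psi>'_def by (auto intro!: derivative_eq_intros)
    show "(G has_real_derivative (m + s) * (\<psi>' s)^2 - (m + s) * (1 - (m + s)^2 / 16) * (\<psi> s)^2) (at s)" for s
      unfolding G_def[abs_def] 
      by (rule DERIV_cong, (rule d DERIV_add DERIV_diff DERIV_cmult)+, simp add: field_simps power2_eq_square power3_eq_cube)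
  qed (simp_all add: \<psi>_def power2_eq_square)
  \<comment> \<open>The definite integrals over the test interval, exact because all data are
    rational. With them the Rayleigh functional is a cubic in m.\<close>
  moreover have n: "A0 (187 / 100) - A0 (- (187 / 100)) = (164398460286929 / 7500000000000)" "A1 (187 / 100) - A1 (- (187 / 100)) = (-1600685727949 / 93750000000)"
    "B0 (187 / 100) - B0 (- (187 / 100)) = (970651938048648581 / 37500000000000000)" "B1 (187 / 100) - B1 (- (187 / 100)) = (-7996339888664083 / 937500000000000)"
    "B2 (187 / 100) - B2 (- (187 / 100)) = (109657655132737017602923 / 7875000000000000000000)" "B3 (187 / 100) - B3 (- (187 / 100)) = (-279624009566694318427 / 28125000000000000000)"
    unfolding A0_def A1_def B0_def B1_def B2_def B3_def by (simp_all add: power_divide)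
  moreover have "G (187 / 100) - G (- (187 / 100)) = 
      m * (A0 (187 / 100) - A0 (- (187 / 100))) + (A1 (187 / 100) - A1 (- (187 / 100)))
      - m * (B0 (187 / 100) - B0 (- (187 / 100))) - (B1 (187 / 100) - B1 (- (187 / 100)))
      + 1 / 16 * (m^3 * (B0 (187 / 100) - B0 (- (187 / 100))) + 3 * m^2 * (B1 (187 / 100) - B1 (- (187 / 100)))
        + 3 * m * (B2 (187 / 100) - B2 (- (187 / 100))) + (B3 (187 / 100) - B3 (- (187 / 100))))"
    unfolding G_def by (simp only: algebra_simps)
  then have "G (187 / 100) - G (- (187 / 100)) = (970651938048648581 / 600000000000000000) * m^3 - (7996339888664083 / 5000000000000000) * m^2 - (18947045958315664372359 / 14000000000000000000000) * m - (4124672357163134478427 / 450000000000000000000)"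
    unfolding n by (simp add: algebra_simps)
  ultimately have "0 \<le> (970651938048648581 / 600000000000000000) * m^3 - (7996339888664083 / 5000000000000000) * m^2 - (18947045958315664372359 / 14000000000000000000000) * m - (4124672357163134478427 / 450000000000000000000)" by linarith
  moreover have "m \<ge> 187 / 100" "m \<le> 2346 / 1000"
  proof -
    show "m \<ge> 187 / 100" using m rm_pos by linarith
    show "m \<le> 2346 / 1000" using power2_le_imp_le[of m "2346/1000"] m(3) by (simp add: power2_eq_square)
  qed
  \<comment> \<open>The cubic is bounded in Horner form from the innermost bracket outwards, each
    time with the largest admissible m; 22/10 and 382/100 are rounded intermediate values.\<close>
  moreover have "(970651938048648581 / 600000000000000000) * m^3 - (7996339888664083 / 5000000000000000) * m^2 - (18947045958315664372359 / 14000000000000000000000) * m - (4124672357163134478427 / 450000000000000000000) < 0"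
  proof -
    have "(970651938048648581 / 600000000000000000) * m - (7996339888664083 / 5000000000000000) \<le> 22 / 10" using \<open>m \<le> 2346 / 1000\<close> by simp
    then have "m * ((970651938048648581 / 600000000000000000) * m - (7996339888664083 / 5000000000000000)) \<le> m * (22 / 10)"
      using \<open>m \<ge> 187 / 100\<close> by (intro mult_left_mono) auto
    also have "\<dots> \<le> (18947045958315664372359 / 14000000000000000000000) + 382 / 100" using \<open>m \<le> 2346 / 1000\<close> by simp
    finally have "m * (m * ((970651938048648581 / 600000000000000000) * m - (7996339888664083 / 5000000000000000)) - (18947045958315664372359 / 14000000000000000000000)) \<le> m * (382 / 100)"
      using \<open>m \<ge> 187 / 100\<close> by (intro mult_left_mono) auto
    also have "\<dots> < (4124672357163134478427 / 450000000000000000000)" using \<open>m \<le> 2346 / 1000\<close> by simp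
    finally show ?thesis by (simp add: power2_eq_square power3_eq_cube algebra_simps)
  qed
  ultimately show False by (meson not_le)
qed

text \<open>With u = 2 N + D this is, after clearing denominators, the estimate that the
  inverse-square correction does not spoil the Rayleigh quotient in
  \<open>no_wide_annulus\<close>.\<close>

lemma width_polynomial_pos:
  fixes D :: real
  assumes "2 \<le> N" "0 < D" "D < 7 / 2"
  shows "6 * N * (N - 2) * (2 * N + D) < (8 * N - D^2) * (2 * N + D - 7 / 2)^2"
proof -
  define t where "t = 7 / 2 - D"
  have t: "0 < t" "t < 7 / 2" using assms by (auto simp: t_def)
  \<comment> \<open>Apart from the square completed at 22/10 the bracket is linear in N with
    positive slope, so N = 2 is the worst case.\<close>
  have bracket: "20 * (N - 22 / 10)^2 + 12 / 10 + D * (26 - 4 * D) * N - 44 * D + 22 * D^2 - 4 * D^3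
      \<ge> 12 / 10 + D * (8 + 4 * D * t)" (is "?B \<ge> _")
  proof -
    have "D * (26 - 4 * D) * 2 \<le> D * (26 - 4 * D) * N"
      using assms by (intro mult_left_mono mult_nonneg_nonneg) auto
    then have "?B \<ge> 12 / 10 + D * (26 - 4 * D) * 2 - 44 * D + 22 * D^2 - 4 * D^3"
      using zero_le_power2[of "N - 22 / 10"] by linarith
    also have "12 / 10 + D * (26 - 4 * D) * 2 - 44 * D + 22 * D^2 - 4 * D^3 = 12 / 10 + D * (8 + 4 * D * t)"
      by (simp add: t_def power2_eq_square power3_eq_cube algebra_simps)
    finally show ?thesis .
  qed
  have "D^2 * t^2 \<le> 2 * (D * (4 * D * t))"
  proof -
    have "D^2 * t * t \<le> D^2 * t * 8" using t assms by (intro mult_left_mono) auto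
    then show ?thesis by (simp add: power2_eq_square algebra_simps)
  qed
  also have "\<dots> < 2 * (12 / 10 + D * (8 + 4 * D * t))" using assms by (simp add: algebra_simps)
  also have "\<dots> \<le> N * ?B" using bracket assms t by (intro mult_mono) auto
  finally have "0 < N * ?B - D^2 * t^2" by simp
  also have "\<dots> = (8 * N - D^2) * (2 * N + D - 7 / 2)^2 - 6 * N * (N - 2) * (2 * N + D)"
    by (simp add: t_def power2_eq_square power3_eq_cube algebra_simps add_divide_distrib diff_divide_distrib)
  finally show ?thesis by simp
qed

text \<open>For N >= 2 the inverse-square term is repulsive or absent, so the symmetrized potential
  has an even quadratic lower bound, and a parabola suffices as test function.\<close>

lemma no_wide_annulus:
  assumes N2: "2 \<le> N" and m: "rm < m - 187 / 100" "m + 187 / 100 < rp" 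
    and D: "2 * N < m^2" "m^2 < 2 * N + 7 / 2"
  shows False
proof -
  define e :: real where "e = 187 / 100"
  define u where "u = m^2"
  define K where "K = N * (N - 2)"
  \<comment> \<open>\<open>\<alpha>\<close> is the symmetrized potential at s = 0;
    \<open>\<beta>\<close> bounds its loss per s^2, with s^2 < 7/2 inserted in the
    denominator.\<close>
  define \<alpha> where "\<alpha> = 3 / 2 + N / 2 - u / 8 - K / (2 * u)"
  define \<beta> where "\<beta> = 1 / 8 + 3 * K / (2 * (u - 7 / 2)^2)"
  define \<psi> where "\<psi> s = e^2 - s^2" for s :: real
  define G where "G s = 8 / 3 * s^3 - \<alpha> * (e^4 * s - 2 / 3 * e^2 * s^3 + 1 / 5 * s^5) 
    + \<beta> * (1 / 3 * e^4 * s^3 - 2 / 5 * e^2 * s^5 + 1 / 7 * s^7)" for s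
  have u: "u > 4" using D N2 by (simp add: u_def)
  have mp: "m > 187 / 100" using m rm_pos by linarith
  have K: "K \<ge> 0" using N2 by (simp add: K_def)
  have "G 0 \<le> G e"
  proof (rule picone_folded[of e m \<psi> "\<lambda>s. - 2 * s" G "\<lambda>s. 2 * (- 2 * s)^2 - (\<alpha> - \<beta> * s^2) * (\<psi> s)^2"])
    show "(\<psi> has_real_derivative - 2 * s) (at s)" for s
      unfolding \<psi>_def[abs_def] by (auto intro!: derivative_eq_intros)
    show "(G has_real_derivative 2 * (- 2 * s)^2 - (\<alpha> - \<beta> * s^2) * (\<psi> s)^2) (at s)" for s
      unfolding G_def[abs_def] \<psi>_def 
      by (rule DERIV_cong, (rule DERIV_add DERIV_diff DERIV_cmult DERIV_ident DERIV_pow)+, 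
        simp add: field_simps power2_eq_square eval_nat_numeral)
    fix s assume s: "0 < s" "s < e"
    have s2: "s^2 < 7 / 2"
    proof -
      have "s^2 \<le> e^2" using s by (intro power_mono) auto
      also have "\<dots> < 7 / 2" by (simp add: e_def power2_eq_square)
      finally show ?thesis .
    qed
    have nz: "m + s \<noteq> 0" "m - s \<noteq> 0" using s mp by (auto simp: e_def)
    define A where "A = (u + s^2) / (u - s^2)^2"
    define Z where "Z = 3 * s^2 / (u - 7 / 2)^2"
    have "1 / (m + s)^2 + 1 / (m - s)^2 = 2 * A"
    proof -
      have "u - s^2 = (m + s) * (m - s)" by (simp add: u_def power2_eq_square algebra_simps)
      then show ?thesis unfolding A_def using nz 
        by (simp add: u_def divide_simps power_mult_distrib) (simp add: power2_eq_square algebra_simps)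
    qed
    moreover have "(m + s)^2 + (m - s)^2 = 2 * (u + s^2)" by (simp add: u_def power2_eq_square algebra_simps)
    moreover have "potential (m + s) + potential (m - s) = 3 / 2 + N / 2 - ((m + s)^2 + (m - s)^2) / 16 
        - K / 4 * (1 / (m + s)^2 + 1 / (m - s)^2)"
      unfolding distrib_left add_divide_distrib by (simp add: potential_def K_def)
    ultimately have "potential (m + s) + potential (m - s) = 3 / 2 + N / 2 - (u + s^2) / 8 - K / 4 * (2 * A)"
      by simp
    moreover have "K / 4 * (2 * A) \<le> K / (2 * u) + K / 2 * Z"
    proof -
      have "A - 1 / u = s^2 * (3 * u - s^2) / (u * (u - s^2)^2)"
      proof -
        have "u - s^2 \<noteq> 0" "u \<noteq> 0" using u s2 by auto
        then show ?thesis unfolding A_def by (simp add: divide_simps) (simp add: power2_eq_square algebra_simps)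
      qed
      also have "\<dots> \<le> s^2 * (3 * u) / (u * (u - s^2)^2)"
        using u by (intro divide_right_mono mult_left_mono) auto
      also have "\<dots> = 3 * s^2 / (u - s^2)^2" using u by simp
      also have "\<dots> \<le> Z" unfolding Z_def
        using u s2 by (intro divide_left_mono power_mono mult_pos_pos zero_less_power) auto
      finally have "K / 4 * (2 * A) \<le> K / 4 * (2 * (1 / u + Z))" using K by (intro mult_left_mono) auto
      also have "\<dots> = K / (2 * u) + K / 2 * Z" using u by (simp add: field_simps)
      finally show ?thesis .
    qed
    moreover have "\<beta> * s^2 = s^2 / 8 + K / 2 * Z" by (simp add: \<beta>_def Z_def algebra_simps)
    ultimately have "\<alpha> - \<beta> * s^2 \<le> potential (m + s) + potential (m - s)"
      unfolding \<alpha>_def by (simp add: add_divide_distrib)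
    then have "(\<alpha> - \<beta> * s^2) * (\<psi> s)^2 \<le> (potential (m + s) + potential (m - s)) * (\<psi> s)^2"
      by (intro mult_right_mono) auto
    then show "2 * (- 2 * s)^2 - (potential (m + s) + potential (m - s)) * (\<psi> s)^2 
       \<le> 2 * (- 2 * s)^2 - (\<alpha> - \<beta> * s^2) * (\<psi> s)^2" by simp
  qed (use m in \<open>auto simp: e_def \<psi>_def\<close>)
  moreover have "G 0 = 0" by (simp add: G_def)
  moreover have "G e = 8 * e^3 / 15 * (5 - e^2 * (\<alpha> - \<beta> * (e^2 / 7)))"
    by (simp add: G_def eval_nat_numeral algebra_simps)
  \<comment> \<open>For the weight \<psi>^2 the mean of s^2 is e^2/7, which is below 1/2. This
    leaves 3/2 - 1/16 = 23/16 for the mean potential, and 187/100 is large enough for 23/16 e^2 >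
    5.\<close>
  moreover have "e^2 * (\<alpha> - \<beta> * (e^2 / 7)) > 5"
  proof -
    have "23 / 16 \<le> \<alpha> - \<beta> / 2"
    proof -
      have "6 * K * u < (8 * N - (u - 2 * N)^2) * (u - 7 / 2)^2"
        using width_polynomial_pos[of "u - 2 * N"] N2 D by (simp add: K_def u_def algebra_simps)
      then have "6 * K * u / (8 * u * (u - 7 / 2)^2) \<le> (8 * N - (u - 2 * N)^2) * (u - 7 / 2)^2 / (8 * u * (u - 7 / 2)^2)"
        using u by (intro divide_right_mono) auto
      also have "\<dots> = (8 * N - (u - 2 * N)^2) / (8 * u)" using u by simp
      also have "\<dots> = N / 2 - u / 8 - K / (2 * u)"
        using u by (simp add: K_def field_simps power2_eq_square)
      also have "6 * K * u / (8 * u * (u - 7 / 2)^2) = 3 * K / (4 * (u - 7 / 2)^2)"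
        using u by simp
      finally have "3 * K / (4 * (u - 7 / 2)^2) \<le> N / 2 - u / 8 - K / (2 * u)" .
      moreover have "\<beta> / 2 = 1 / 16 + 3 * K / (4 * (u - 7 / 2)^2)" by (simp add: \<beta>_def add_divide_distrib)
      ultimately show ?thesis unfolding \<alpha>_def by linarith
    qed
    moreover have "\<beta> * (e^2 / 7) \<le> \<beta> / 2"
      using K mult_left_mono[of "e^2 / 7" "1 / 2" \<beta>] by (simp add: \<beta>_def e_def power2_eq_square)
    ultimately have "23 / 16 \<le> \<alpha> - \<beta> * (e^2 / 7)" by linarith
    from mult_left_mono[OF this, of "e^2"] show ?thesis by (simp add: e_def power2_eq_square)
  qed
  moreover have "8 * e^3 / 15 * (5 - X) < 0" if "X > 5" for X
    using that by (intro mult_pos_neg) (simp_all add: e_def)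
  ultimately show False by fastforce
qed

lemma width_less: 
  assumes "N = 1 \<or> 2 \<le> N" shows "rp - rm < sqrt 14"
proof (rule ccontr)
  assume "\<not> ?thesis"
  then have wide: "sqrt 14 \<le> rp - rm" by simp
  \<comment> \<open>The test interval is centred at the midpoint of the inner piece of length sqrt
    14, not at c: then rm (rm + sqrt 14) = m^2 - 7/2, and the product bound limits m.\<close>
  define m where "m = rm + sqrt (7 / 2)"
  have "sqrt 14 = sqrt (4 * (7 / 2))" by simp
  also have "\<dots> = 2 * sqrt (7 / 2)" by (subst real_sqrt_mult) simp
  finally have s14: "sqrt 14 = 2 * sqrt (7 / 2)" .
  have s: "187 / 100 < sqrt (7 / 2)" by (rule real_less_rsqrt) (simp add: power2_eq_square)
  have m: "rm < m - 187 / 100" "m + 187 / 100 < rp" using s wide s14 by (auto simp: m_def)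
  have "rm * (rm + 2 * sqrt (7 / 2)) \<le> rm * rp" using wide s14 rm_pos by (intro mult_left_mono) auto
  also have "\<dots> < 2 * N" by (rule rm_rp_less)
  also have "rm * (rm + 2 * sqrt (7 / 2)) = m^2 - 7 / 2"
    by (simp add: m_def power2_sum power2_eq_square algebra_simps)
  finally have u: "m^2 < 2 * N + 7 / 2" by simp
  have "r0 < m" using rm_lower s scaled_kappa_bounds by (simp add: m_def)
  then have l: "2 * N < m^2" using r0_ge power_strict_mono[of r0 m 2] r0_sq N_ge_1 by (simp add: r0_def)
  show False using no_wide_annulus[of m] no_wide_annulus_planar[of m] m u l assms by auto
qed

lemma d_sq_less: 
  assumes "N = 1 \<or> 2 \<le> N" shows "d^2 < 7 / 2"
proof -
  have "(rp - rm)^2 < (sqrt 14)^2" using width_less[OF assms] rm_less_rp by (intro power_strict_mono) auto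
  then show ?thesis by (simp add: d_def power_divide)
qed

end

section \<open>Convexity of the derivative\<close>

context annular
begin

text \<open>The differential equation turns the second to fourth derivatives of \<open>f\<close> into the expressions
  \<open>g1\<close>, \<open>g2\<close>, \<open>g3\<close> in \<open>f\<close> and \<open>g\<close>.\<close>

definition g1 :: "real \<Rightarrow> real" where
  "g1 r = b r * g r - f r / 2"

definition g2 :: "real \<Rightarrow> real" where
  "g2 r = b r * g1 r + N * g r / r^2"

lemma g_deriv1: "rm < r \<Longrightarrow> r < rp \<Longrightarrow> (g has_real_derivative g1 r) (at r)"
  using g_deriv0 by (simp add: g1_def)

lemma g1_deriv0:
  assumes "rm < r" "r < rp" shows "(g1 has_real_derivative g2 r) (at r)"
proof -
  have "(g1 has_real_derivative ((1 / 2 + N / r^2) * 1 * g r + g1 r * b r) - g r / 2) (at r)"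
    unfolding g1_def[abs_def] using assms rm_pos
    by (intro DERIV_diff DERIV_mult DERIV_cdivide f_deriv0 g_deriv0 drift_deriv DERIV_ident) auto
  moreover have "((1 / 2 + N / r^2) * 1 * g r + g1 r * b r) - g r / 2 = g2 r"
    by (simp add: g2_def algebra_simps)
  ultimately show ?thesis by simp
qed

lemma g1_deriv [derivative_intros]:
  assumes "(h has_real_derivative h') (at x)" "rm < h x" "h x < rp"
  shows "((\<lambda>x. g1 (h x)) has_real_derivative g2 (h x) * h') (at x)"
  using DERIV_chain2[OF g1_deriv0 assms(1)] assms by simp

definition g3 :: "real \<Rightarrow> real" where
  "g3 r = ((b r)^2 + 1 / 2 + 2 * N / r^2) * g1 r + N * g r / r^3 * (b r * r - 2)"

lemma g3_alt: "r > 0 \<Longrightarrow> g3 r = b r * g2 r + ((1 / 2 + 2 * N / r^2) * g1 r - 2 * N * g r / r^3)"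
  by (simp add: g3_def g2_def field_simps power2_eq_square power3_eq_cube)

lemma g2_deriv0:
  assumes "rm < r" "r < rp" shows "(g2 has_real_derivative g3 r) (at r)"
proof -
  have r: "r > 0" using assms rm_pos by simp
  define q where "q r = 1 / r^2" for r :: real
  have q: "(q has_real_derivative - 2 / r^3) (at r)"
    unfolding q_def[abs_def] using r
    by (auto intro!: derivative_eq_intros simp: field_simps power2_eq_square power3_eq_cube)
  have "((\<lambda>r. b r * g1 r + N * (g r * q r)) has_real_derivative
    ((1 / 2 + N / r^2) * 1 * g1 r + g2 r * b r) + N * (g1 r * q r + - 2 / r^3 * g r)) (at r)"
    using assms r q by (intro DERIV_add DERIV_mult DERIV_cmult g1_deriv0 g_deriv1 drift_deriv DERIV_ident) auto
  moreover have "(\<lambda>r. b r * g1 r + N * (g r * q r)) = g2"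
    by (auto simp: g2_def q_def)
  moreover have "((1 / 2 + N / r^2) * 1 * g1 r + g2 r * b r) + N * (g1 r * q r + - 2 / r^3 * g r) = g3 r"
    unfolding g3_alt[OF r] by (simp add: q_def algebra_simps)
  ultimately show ?thesis by simp
qed

section \<open>Concavity of f and signs of its third and fourth derivatives\<close>

lemma drift_times: "r > 0 \<Longrightarrow> b r * r = r^2 / 2 - N"
  by (simp add: drift_def field_simps power2_eq_square)

lemma r0_pos: "r0 > 0"
  using N_ge_1 by (simp add: r0_def)

lemma drift_pos: 
  assumes "r > r0" shows "b r > 0"
proof -
  have r: "r > 0" using assms r0_pos by simp
  have "r^2 > r0^2" using assms r0_pos by (intro power_strict_mono) auto
  then have "b r * r > 0" using drift_times[OF r] r0_sq by simp
  then show ?thesis using r by (simp add: zero_less_mult_iff)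
qed

lemma exists_max:
  obtains m where "c < m" "m < rp" "g m = 0" 
    "\<And>r. rm \<le> r \<Longrightarrow> r < m \<Longrightarrow> g r > 0" "\<And>r. m < r \<Longrightarrow> r \<le> rp \<Longrightarrow> g r < 0"
proof -
  have crp: "c < rp" "rm < c" using c_plus_d c_minus_d d_pos by linarith+
  obtain m where m: "c \<le> m" "m \<le> rp" "g m = 0"
    using IVT2'[of g rp 0 c] g_rp g_c_pos crp continuous_on_subset[OF g_cont, of "{c..rp}"] by auto
  have "m \<noteq> c" "m \<noteq> rp" using m g_c_pos g_rp by auto
  show ?thesis
    by (rule that[of m]) (use m \<open>m \<noteq> c\<close> \<open>m \<noteq> rp\<close> crp g_pos_left[of _ m] g_neg_right[of m] in auto)
qed

text \<open>Left of the maximum \<open>weight r * g1 r\<close> increases towards its value at the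
  maximum, which is - weight f / 2. Right of it the drift is positive, because the maximum lies
  beyond \<open>r0\<close>, and no term is positive.\<close>

lemma g1_neg:
  assumes r: "rm < r" "r < rp" shows "g1 r < 0"
proof -
  obtain m where m: "c < m" "m < rp" "g m = 0" "\<And>r. rm \<le> r \<Longrightarrow> r < m \<Longrightarrow> g r > 0"
    "\<And>r. m < r \<Longrightarrow> r \<le> rp \<Longrightarrow> g r < 0" by (rule exists_max) (rule that)
  show ?thesis
  proof (cases "r < m")
    case True
    have "weight r * g1 r < weight m * g1 m"
    proof (rule increasing_if_deriv_pos[OF True, where F = "\<lambda>r. weight r * g1 r" and F' = "\<lambda>r. weight r * (N * g r / r^2)"])
      have der: "((\<lambda>r. weight r * g1 r) has_real_derivative weight x * (N * g x / x^2)) (at x)"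
        if "r \<le> x" "x \<le> m" for x
      proof -
        have "((\<lambda>r. weight r * g1 r) has_real_derivative (- b x * weight x * 1) * g1 x + g2 x * weight x) (at x)"
          using that r m rm_pos by (intro DERIV_mult gauss_weight_deriv DERIV_ident g1_deriv0) auto
        then show ?thesis by (rule DERIV_cong) (simp add: g2_def algebra_simps)
      qed
      show "continuous_on {r..m} (\<lambda>r. weight r * g1 r)"
        by (intro continuous_at_imp_continuous_on ballI DERIV_isCont[OF der]) auto
      fix x assume x: "r < x" "x < m"
      show "((\<lambda>r. weight r * g1 r) has_real_derivative weight x * (N * g x / x^2)) (at x)"
        using der x by simp
      show "0 < weight x * (N * g x / x^2)"
        using x r m(4)[of x] rm_pos N_ge_1 by (intro mult_pos_pos divide_pos_pos gauss_weight_pos) auto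
    qed
    also have "weight m * g1 m < 0"
      using f_pos[of m] gauss_weight_pos[of m N] m r True rm_pos by (simp add: g1_def mult_pos_neg)
    finally show ?thesis using gauss_weight_pos[of r N] r rm_pos by (simp add: mult_less_0_iff)
  next
    case False
    then have "b r > 0" using drift_pos r0_less_c m by simp
    moreover have "g r \<le> 0" using False m(3) m(5)[of r] r by (cases "r = m") auto
    ultimately show ?thesis using f_pos[OF r] by (simp add: g1_def) (smt (verit) mult_nonneg_nonpos)
  qed
qed

text \<open>Concavity makes the weighted f''' decrease wherever f is increasing, so its positivity
  propagates to the left.\<close>

lemma g2_weight_decreasing:
  assumes "rm < u" "u < r" "r < rp" "g r \<ge> 0"
  shows "weight r * g2 r < weight u * g2 u"
proof (rule decreasing_if_deriv_neg[OF assms(2), where F = "\<lambda>r. weight r * g2 r" 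
      and F' = "\<lambda>r. weight r * ((1 / 2 + 2 * N / r^2) * g1 r - 2 * N * g r / r^3)"])
  have der: "((\<lambda>r. weight r * g2 r) has_real_derivative 
      weight x * ((1 / 2 + 2 * N / x^2) * g1 x - 2 * N * g x / x^3)) (at x)"
    if "u \<le> x" "x \<le> r" for x
  proof -
    have x: "x > 0" using that assms rm_pos by simp
    have "((\<lambda>r. weight r * g2 r) has_real_derivative (- b x * weight x * 1) * g2 x + g3 x * weight x) (at x)"
      using that assms rm_pos by (intro DERIV_mult gauss_weight_deriv DERIV_ident g2_deriv0) auto
    then show ?thesis by (rule DERIV_cong) (simp only: g3_alt[OF x], simp add: algebra_simps)
  qed
  show "continuous_on {u..r} (\<lambda>r. weight r * g2 r)"
    by (intro continuous_at_imp_continuous_on ballI DERIV_isCont[OF der]) auto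
  fix x assume x: "u < x" "x < r"
  show "((\<lambda>r. weight r * g2 r) has_real_derivative 
      weight x * ((1 / 2 + 2 * N / x^2) * g1 x - 2 * N * g x / x^3)) (at x)"
    using der x by simp
  have xp: "x > 0" using x assms rm_pos by simp
  have "g1 x < 0" using x assms by (intro g1_neg) auto
  then have "(1 / 2 + 2 * N / x^2) * g1 x < 0" using N_ge_1 by (intro mult_pos_neg add_pos_nonneg) auto
  moreover have "2 * N * g x / x^3 \<ge> 0" using g_pos_left[of x r] x assms xp N_ge_1 by simp
  ultimately show "weight x * ((1 / 2 + 2 * N / x^2) * g1 x - 2 * N * g x / x^3) < 0"
    using gauss_weight_pos[OF xp] by (intro mult_pos_neg) auto
qed

lemma g2_pos_left:
  assumes "rm < u" "u \<le> r" "r < rp" "g r \<ge> 0" "g2 r > 0"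
  shows "g2 u > 0"
proof (cases "u = r")
  case False
  then have "weight r * g2 r < weight u * g2 u" using assms by (intro g2_weight_decreasing) auto
  moreover have "weight r * g2 r > 0" using assms rm_pos by (intro mult_pos_pos gauss_weight_pos) auto
  ultimately have "weight u * g2 u > 0" by linarith
  then show ?thesis using gauss_weight_pos[of u N] assms rm_pos by (simp add: zero_less_mult_iff)
qed (use assms in simp)

text \<open>While \<open>f'''\<close> is positive, \<open>f'\<close> is convex and \<open>f\<close> dominates the integral of the tangent of \<open>f'\<close> at \<open>r\<close>.\<close>

lemma tangent_bound:
  assumes r: "rm < r" "r < rp" and g: "g r \<ge> 0" and g2: "g2 r > 0"
  shows "g r * ((r - rm) * (1 - b r * (r - rm) / 2)) \<le> f r * (1 - (r - rm)^2 / 4)"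
proof -
  have g1_le: "g1 u \<le> g1 r" if u: "rm < u" "u \<le> r" for u
  proof (rule nondecreasing_if_deriv_nonneg[OF u(2), where F = g1 and F' = g2])
    show "continuous_on {u..r} g1"
      using u r by (intro continuous_at_imp_continuous_on ballI DERIV_isCont[OF g1_deriv0]) auto
  qed (use u r g g2 g1_deriv0 in \<open>auto intro!: less_imp_le g2_pos_left[of _ r]\<close>)
  have g_ge: "g r + g1 r * (u - r) \<le> g u" if u: "rm < u" "u \<le> r" for u
  proof -
    have "g u - g1 r * (u - r) \<ge> g r - g1 r * (r - r)"
    proof -
      have "- (g u - g1 r * (u - r)) \<le> - (g r - g1 r * (r - r))"
      proof (rule nondecreasing_if_deriv_nonneg[OF u(2), where F = "\<lambda>u. - (g u - g1 r * (u - r))" and F' = "\<lambda>u. - (g1 u - g1 r)"])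
        show "continuous_on {u..r} (\<lambda>u. - (g u - g1 r * (u - r)))"
          using u r by (intro continuous_intros) auto
        fix x assume x: "u < x" "x < r"
        show "((\<lambda>u. - (g u - g1 r * (u - r))) has_real_derivative - (g1 x - g1 r)) (at x)"
          using x u r by (auto intro!: derivative_eq_intros simp: g1_def)
        show "0 \<le> - (g1 x - g1 r)" using g1_le[of x] x u by simp
      qed
      then show ?thesis by simp
    qed
    then show ?thesis by simp
  qed
  have "f rm - (g r * (rm - r) + g1 r * (rm - r)^2 / 2) \<le> f r - (g r * (r - r) + g1 r * (r - r)^2 / 2)"
  proof (rule nondecreasing_if_deriv_nonneg[where F = "\<lambda>u. f u - (g r * (u - r) + g1 r * (u - r)^2 / 2)"
        and F' = "\<lambda>u. g u - (g r + g1 r * (u - r))"])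
    show "continuous_on {rm..r} (\<lambda>u. f u - (g r * (u - r) + g1 r * (u - r)^2 / 2))"
      using r by (intro continuous_intros) auto
    fix x assume x: "rm < x" "x < r"
    show "((\<lambda>u. f u - (g r * (u - r) + g1 r * (u - r)^2 / 2)) has_real_derivative g x - (g r + g1 r * (x - r))) (at x)"
      using x r by (auto intro!: derivative_eq_intros f_deriv0)
    show "0 \<le> g x - (g r + g1 r * (x - r))" using g_ge[of x] x by simp
  qed (use r in simp)
  then have "g r * (r - rm) - g1 r * (r - rm)^2 / 2 \<le> f r"
    using f_rm by (simp add: power2_commute algebra_simps)
  then show ?thesis by (simp add: g1_def field_simps power2_eq_square)
qed

text \<open>The only term that can be positive is \<open>- 2 * N * g r / r^3\<close>. Past the
  maximum \<open>m\<close> the function \<open>g1\<close> decreases, so \<open>- g r\<close> is at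
  most \<open>- g1 r * (r - m)\<close>, and \<open>2 * N / r^2 * g1 r\<close> absorbs the
  term.\<close>

lemma g3_nonpos_right:
  assumes r: "rm < r" "r < rp" and g: "g r \<le> 0" shows "g3 r \<le> 0"
proof -
  obtain m where m: "c < m" "m < rp" "g m = 0" "\<And>r. rm \<le> r \<Longrightarrow> r < m \<Longrightarrow> g r > 0"
    "\<And>r. m < r \<Longrightarrow> r \<le> rp \<Longrightarrow> g r < 0" by (rule exists_max) (rule that)
  have rp0: "r > 0" using r rm_pos by simp
  have mr: "m \<le> r" using m(4)[of r] g r by fastforce
  have mp: "m > rm" using m(1) c_minus_d d_pos by linarith
  have g2: "g2 u < 0" if u: "m \<le> u" "u < rp" for u
  proof -
    have "b u > 0" using drift_pos r0_less_c m u by simp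
    moreover have "g u \<le> 0" using m(3) m(5)[of u] u by (cases "u = m") auto
    moreover have "g1 u < 0" using u mp by (intro g1_neg) auto
    ultimately show ?thesis unfolding g2_def using N_ge_1
      by (intro add_neg_nonpos mult_pos_neg divide_nonpos_nonneg mult_nonneg_nonpos) auto
  qed
  have g1_ge: "g1 r \<le> g1 u" if u: "m \<le> u" "u \<le> r" for u
  proof -
    have "- g1 u \<le> - g1 r"
    proof (rule nondecreasing_if_deriv_nonneg[OF u(2), where F = "\<lambda>u. - g1 u" and F' = "\<lambda>u. - g2 u"])
      show "continuous_on {u..r} (\<lambda>u. - g1 u)"
        using u r mp by (intro continuous_at_imp_continuous_on ballI DERIV_isCont[OF DERIV_minus[OF g1_deriv0]]) auto
    qed (use u r mp in \<open>auto intro!: DERIV_minus g1_deriv0 less_imp_le[OF g2]\<close>)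
    then show ?thesis by simp
  qed
  have "g m - g1 r * (m - m) \<le> g r - g1 r * (r - m)"
  proof (rule nondecreasing_if_deriv_nonneg[OF mr, where F = "\<lambda>u. g u - g1 r * (u - m)" and F' = "\<lambda>u. g1 u - g1 r"])
    show "continuous_on {m..r} (\<lambda>u. g u - g1 r * (u - m))"
      using mp r by (intro continuous_intros) auto
    fix x assume x: "m < x" "x < r"
    show "((\<lambda>u. g u - g1 r * (u - m)) has_real_derivative g1 x - g1 r) (at x)"
      using x r mp by (auto intro!: derivative_eq_intros simp: g1_def)
    show "0 \<le> g1 x - g1 r" using g1_ge[of x] x by simp
  qed
  then have "- g r \<le> - g1 r * (r - m)" using m(3) by simp
  also have "\<dots> \<le> - g1 r * r" using g1_neg[OF r] mp rm_pos by (intro mult_left_mono) auto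
  finally have "(2 * N / r^3) * (- g r) \<le> (2 * N / r^3) * (- g1 r * r)"
    using rp0 N_ge_1 by (intro mult_left_mono) auto
  also have "\<dots> = - (2 * N / r^2 * g1 r)" using rp0 by (simp add: field_simps power2_eq_square power3_eq_cube)
  finally have 1: "- 2 * N * g r / r^3 \<le> - (2 * N / r^2 * g1 r)" by simp
  have 2: "((b r)^2 + 1 / 2) * g1 r \<le> 0" using g1_neg[OF r] by (intro mult_nonneg_nonpos) auto
  have "b r > 0" using drift_pos r0_less_c m mr by simp
  then have 3: "b r * (N * g r / r^2) \<le> 0" 
    using g N_ge_1 by (intro mult_nonneg_nonpos divide_nonpos_nonneg) auto
  have "g3 r = ((b r)^2 + 1 / 2) * g1 r + b r * (N * g r / r^2) + (2 * N / r^2 * g1 r - 2 * N * g r / r^3)"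
    unfolding g3_alt[OF rp0] by (simp add: g2_def algebra_simps power2_eq_square)
  then show ?thesis using 1 2 3 by simp
qed

end

text \<open>Integrality is used only through the case list N = 1, 2, 3 or N >= 4, to which the
  rational estimates are fitted.\<close>

locale annular_nat = annular +
  assumes N_nat: "N \<in> \<nat>"
begin

lemma N_cases: "N = 1 \<or> N = 2 \<or> N = 3 \<or> 4 \<le> N"
proof -
  obtain k :: nat where k: "N = real k" using N_nat by (auto elim: Nats_cases)
  then have "k = 1 \<or> k = 2 \<or> k = 3 \<or> 4 \<le> k" using N_ge_1 by auto
  then show ?thesis using k by auto
qed

lemma d_sq: "d^2 < 7 / 2"
  using d_sq_less N_cases by auto

lemma rm_le_low:
  assumes "l \<le> r0" "0 < l" "2 * N \<le> x * (l + 16437 / 10000)" 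
  shows "rm \<le> x"
proof -
  have p: "l + 16437 / 10000 > 0" using assms by simp
  have "rm \<le> r0^2 / (r0 + scaled_kappa)" using rm_upper by simp
  also have "\<dots> \<le> r0^2 / (l + 16437 / 10000)"
    using assms scaled_kappa_bounds p by (intro divide_left_mono mult_pos_pos) auto
  also have "\<dots> \<le> x" using assms p by (simp add: pos_divide_le_eq r0_sq)
  finally show ?thesis .
qed

lemma r0_lower: "x^2 \<le> 2 * N \<Longrightarrow> x \<le> r0"
  using power2_le_imp_le[of x r0] r0_sq r0_pos by simp

text \<open>At \<open>r1\<close> one has b(r) r = 2, the threshold beyond which \<open>g3\<close>
  has a term of the wrong sign. Positive \<open>g2\<close> bounds f above by a multiple of g, while
  \<open>tangent_bound\<close> bounds f below; the explicit radii make these incompatible.\<close>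

lemma g2_nonpos_low_dim:
  assumes N: "N = 1 \<or> N = 2 \<or> N = 3" and r1: "r1 > 0" "r1^2 = 2 * N + 4" "r1 < rp" and g: "g r1 > 0"
  shows "g2 r1 \<le> 0"
proof (rule ccontr)
  assume "\<not> ?thesis"
  then have g2: "g2 r1 > 0" by simp
  have r1_lower: "x \<le> r1" if "x^2 \<le> 2 * N + 4" for x
    using power2_le_imp_le[of x r1] r1 that by simp
  have r1_bounds: "N = 1 \<Longrightarrow> 2449 / 1000 \<le> r1" "N = 2 \<Longrightarrow> 2828 / 1000 \<le> r1" "N = 3 \<Longrightarrow> 3162 / 1000 \<le> r1"
    by (rule r1_lower; simp add: power_divide)+
  have r0_bounds: "N = 1 \<Longrightarrow> 1414 / 1000 \<le> r0" "N = 2 \<Longrightarrow> 2 \<le> r0" "N = 3 \<Longrightarrow> 2449 / 1000 \<le> r0"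
    by (rule r0_lower; simp add: power_divide)+
  \<comment> \<open>The three bounds on \<open>rm\<close> round up 2N / (l + 1.6437), where
    \<open>l\<close> is the rational lower bound for \<open>r0\<close>.\<close>
  have rm_bounds: "rm \<le> 655 / 1000" if "N = 1"
    by (rule rm_le_low[OF r0_bounds(1)[OF that]]) (simp_all add: that)
  have rm_bounds2: "rm \<le> 1098 / 1000" if "N = 2"
    by (rule rm_le_low[OF r0_bounds(2)[OF that]]) (simp_all add: that)
  have rm_bounds3: "rm \<le> 1467 / 1000" if "N = 3"
    by (rule rm_le_low[OF r0_bounds(3)[OF that]]) (simp_all add: that)
  note rm_bounds = rm_bounds rm_bounds2 rm_bounds3
  define l where "l = r1 - rm"
  have l_bounds: "N = 1 \<Longrightarrow> 1794 / 1000 \<le> l" "N = 2 \<Longrightarrow> 173 / 100 \<le> l" "N = 3 \<Longrightarrow> 1695 / 1000 \<le> l"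
    using r1_bounds rm_bounds by (auto simp: l_def)
  have rmr1: "rm < r1" using r1_bounds rm_bounds N by auto
  have l: "0 < l" "l < r1" using rm_pos rmr1 by (auto simp: l_def)
  have br: "b r1 = 2 / r1" using drift_times[OF r1(1)] r1 by (simp add: field_simps)
  have "b r1 * l / 2 = l / r1" by (simp add: br)
  then have tb: "g r1 * (l * (1 - l / r1)) \<le> f r1 * (1 - l^2 / 4)"
    using tangent_bound[OF rmr1 r1(3) less_imp_le[OF g] g2] by (simp only: l_def)
  have "0 < g r1 * (l * (1 - l / r1))" using g l r1 by (intro mult_pos_pos) auto
  then have pos: "1 - l^2 / 4 > 0" using tb f_pos[OF rmr1 r1(3)] by (smt (verit) mult_nonneg_nonpos)
  have "g2 r1 * r1^2 = (4 + N) * g r1 - f r1 * r1"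
    using r1(1) by (simp add: g2_def g1_def br field_simps power2_eq_square)
  then have "f r1 * r1 < (4 + N) * g r1" using g2 r1(1) by (smt (verit) mult_pos_pos zero_less_power)
  then have fg: "f r1 * r1 * (1 - l^2 / 4) < (4 + N) * g r1 * (1 - l^2 / 4)" using pos by simp
  have "g r1 * (l * (r1 - l)) = g r1 * (l * (1 - l / r1)) * r1" using r1(1) by (simp add: field_simps)
  also have "\<dots> \<le> f r1 * (1 - l^2 / 4) * r1" using tb r1(1) by (intro mult_right_mono) auto
  also have "\<dots> = f r1 * r1 * (1 - l^2 / 4)" by (simp only: mult_ac)
  also note fg
  also have "(4 + N) * g r1 * (1 - l^2 / 4) = g r1 * ((4 + N) * (1 - l^2 / 4))" by (simp only: mult_ac)
  finally have "g r1 * (l * (r1 - l)) < g r1 * ((4 + N) * (1 - l^2 / 4))" .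
  then have "l * (r1 - l) < (4 + N) * (1 - l^2 / 4)" using g by simp
  then have lt: "l * r1 + N * (l * l) / 4 < 4 + N" by (simp add: field_simps power2_eq_square)
  \<comment> \<open>The left side of \<open>lt\<close> increases in both lengths, so their rational
    lower bounds already violate it.\<close>
  have "x * y + N * (x * x) / 4 \<le> l * r1 + N * (l * l) / 4" if "0 \<le> x" "x \<le> l" "0 \<le> y" "y \<le> r1" for x y
    using that N_ge_1 by (intro add_mono mult_mono divide_right_mono) auto
  from this[of "1794 / 1000" "2449 / 1000"] this[of "173 / 100" "2828 / 1000"] this[of "1695 / 1000" "3162 / 1000"]
  show False using N lt l_bounds r1_bounds by auto
qed

text \<open>By \<open>rm_upper\<close>, r0 - rm exceeds k r0 / (r0 + k) with k =
  \<open>scaled_kappa\<close>. This increases with r0 and k; r0 >= 2.828 and k > 1.6437 give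
  1.039.\<close>

lemma drift_le_high_dim:
  assumes "4 \<le> N" "0 < r" shows "b r \<le> r - rm - 1039 / 1000"
proof -
  have r0: "2828 / 1000 \<le> r0" 
    by (rule r0_lower) (use assms in \<open>simp add: power_divide\<close>)
  have k: "16437 / 10000 < scaled_kappa" "r0 + scaled_kappa > 0" using scaled_kappa_bounds r0 by auto
  have "2828 / 1000 * (scaled_kappa - 1039 / 1000) \<le> r0 * (scaled_kappa - 1039 / 1000)"
    using r0 k by (intro mult_right_mono) auto
  then have "1039 / 1000 * (r0 + scaled_kappa) \<le> scaled_kappa * r0"
    using k by (simp add: algebra_simps)
  then have "1039 / 1000 \<le> scaled_kappa * r0 / (r0 + scaled_kappa)" using k by (simp add: pos_le_divide_eq)
  also have "\<dots> = r0 - r0^2 / (r0 + scaled_kappa)" using k by (simp add: field_simps power2_eq_square)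
  finally have "1039 / 1000 \<le> r0 - rm" using rm_upper by simp
  then show ?thesis using drift_le_shift[OF assms(2)] by simp
qed

text \<open>The positive term is at most B g / 2 and the negative one at least 4/3 (f/2 - B g) in
  size. The second dominates exactly when 11 B g <= 4 f, which \<open>tangent_bound\<close>
  supplies.\<close>

lemma g3_nonpos_high_dim:
  assumes N: "4 \<le> N" and r: "rm < r" "r < rp" and g: "g r > 0" and g2: "g2 r > 0" and br: "2 < b r * r"
  shows "g3 r \<le> 0"
proof -
  have rp0: "r > 0" using r rm_pos by simp
  define l where "l = r - rm"
  define B where "B = b r"
  have l0: "l > 0" using r by (simp add: l_def)
  \<comment> \<open>At distance 2 from \<open>rm\<close> the right side of
    \<open>tangent_bound\<close> vanishes, which would force b(rm + 2) >= 1; the drift bound gives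
    at most 0.961.\<close>
  have l2: "l < 2"
  proof (rule ccontr)
    assume "\<not> ?thesis"
    then have u: "rm < rm + 2" "rm + 2 \<le> r" "rm + 2 < rp" using r by (auto simp: l_def)
    have gu: "g (rm + 2) > 0" using g_pos_left[of "rm + 2" r] u g r by (cases "rm + 2 = r") auto
    have "g2 (rm + 2) > 0" using g2_pos_left[OF u(1,2)] r g g2 by simp
    then have "g (rm + 2) * (2 * (1 - b (rm + 2))) \<le> 0"
      using tangent_bound[OF u(1,3)] gu by simp
    moreover have "b (rm + 2) < 1" using drift_le_high_dim[OF N, of "rm + 2"] rm_pos by simp
    ultimately show False using gu by (simp add: mult_le_0_iff)
  qed
  have Bl: "B \<le> l - 1039 / 1000" using drift_le_high_dim[OF N rp0] by (simp add: l_def B_def)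
  have B0: "B > 0" using br rp0 by (simp add: B_def) (smt (verit) mult_nonpos_nonneg)
  have ll: "l * l < 4" using l0 l2 mult_strict_mono[of l 2 l 2] by simp
  \<comment> \<open>Up to a positive constant this product is 16 l - (l - 1.039) (44 - 3
    l^2).\<close>
  have "(2 - l) * (22234 / 1000 - 2883 / 1000 * l - 3 * (l * l)) \<ge> 0"
    using l2 ll l0 by (intro mult_nonneg_nonneg) auto
  then have "(l - 1039 / 1000) * (44 - 3 * (l * l)) \<le> 16 * l" by (simp add: field_simps)
  moreover have "B * (44 - 3 * (l * l)) \<le> (l - 1039 / 1000) * (44 - 3 * (l * l))"
    using Bl ll by (intro mult_right_mono) auto
  ultimately have key: "11 * B * (1 - l^2 / 4) \<le> 4 * (l * (1 - B * l / 2))"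
    by (simp add: power2_eq_square algebra_simps)
  have P: "1 - l^2 / 4 > 0" using ll by (simp add: power2_eq_square)
  have "g r * (11 * B * (1 - l^2 / 4)) \<le> g r * (4 * (l * (1 - B * l / 2)))"
    using key g by (intro mult_left_mono) auto
  also have "\<dots> \<le> 4 * (f r * (1 - l^2 / 4))"
    using tangent_bound[OF r less_imp_le[OF g] g2] by (simp add: l_def B_def)
  finally have "(11 * B * g r) * (1 - l^2 / 4) \<le> (4 * f r) * (1 - l^2 / 4)" by (simp add: mult_ac)
  then have bg: "11 * (B * g r) \<le> 4 * f r" using P by simp
  have nr: "N / r^2 = 1 / 2 - B / r" using rp0 by (simp add: B_def drift_def field_simps power2_eq_square)
  have r2: "r^2 > 6" using br N drift_times[OF rp0] by simp
  \<comment> \<open>The coefficient equals (B - 1/r)^2 + 3/2 - 1/r^2, whence 4/3 = 3/2 -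
    1/6.\<close>
  have "1 / r^2 \<le> 1 / 6" using r2 by (intro frac_le) auto
  moreover have "0 \<le> (B - 1 / r)^2" by simp
  then have "0 \<le> B^2 - 2 * B / r + 1 / r^2" by (simp add: power2_diff power_divide)
  moreover have "2 * N / r^2 = 1 - 2 * B / r" using nr by (simp add: mult.assoc times_divide_eq_right[symmetric] del: times_divide_eq_right)
  ultimately have A: "4 / 3 \<le> B^2 + 1 / 2 + 2 * N / r^2" by linarith
  have X: "(B^2 + 1 / 2 + 2 * N / r^2) * (f r / 2 - B * g r) \<ge> 4 / 3 * (f r / 2 - B * g r)"
    using A bg f_pos[OF r] by (intro mult_right_mono) auto
  have Y: "N * g r / r^3 * (B * r - 2) \<le> g r * B / 2"
  proof -
    have "N * g r / r^3 * (B * r - 2) = g r * ((N / r^2) * (B - 2 / r))"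
      using rp0 by (simp add: field_simps power2_eq_square power3_eq_cube)
    also have "(N / r^2) * (B - 2 / r) \<le> 1 / 2 * B"
    proof (rule mult_mono)
      show "N / r^2 \<le> 1 / 2" using nr B0 rp0 by simp
      show "0 \<le> B - 2 / r" using br rp0 by (simp add: B_def field_simps)
    qed (use rp0 in auto)
    finally show ?thesis using g by (simp add: mult_left_mono)
  qed
  have eq: "g3 r = - ((B^2 + 1 / 2 + 2 * N / r^2) * (f r / 2 - B * g r)) + N * g r / r^3 * (B * r - 2)"
    by (simp add: g3_def g1_def B_def algebra_simps)
  have "4 / 3 * (f r / 2 - B * g r) \<le> X \<Longrightarrow> Y \<le> g r * B / 2 \<Longrightarrow> - X + Y \<le> 0" for X Y
    using bg by (simp add: algebra_simps)
  from this[OF X Y] show ?thesis unfolding eq .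
qed

text \<open>For g > 0 the two forms of \<open>g3\<close> settle the cases
  \<open>b r * r \<le> 2\<close> and \<open>g2 r \<le> 0\<close>. Otherwise the estimate for N >= 4
  applies, or positivity of \<open>g2\<close> propagates left to \<open>r1\<close>, where it is
  excluded.\<close>

lemma g3_nonpos:
  assumes r: "rm < r" "r < rp" shows "g3 r \<le> 0"
proof (cases "g r \<le> 0")
  case True
  then show ?thesis using g3_nonpos_right r by simp
next
  case False
  then have g: "g r > 0" by simp
  have rp0: "r > 0" using r rm_pos by simp
  have s: "0 \<le> 1 / 2 + 2 * N / r^2" using N_ge_1 by simp
  show ?thesis
  proof (cases "b r * r \<le> 2")
    case True
    have "((b r)^2 + 1 / 2 + 2 * N / r^2) * g1 r \<le> 0"
      using s g1_neg[OF r] by (intro mult_nonneg_nonpos) (auto simp: add.assoc)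
    moreover have "N * g r / r^3 * (b r * r - 2) \<le> 0"
      using True g rp0 N_ge_1 by (intro mult_nonneg_nonpos) auto
    ultimately show ?thesis by (simp add: g3_def)
  next
    case False
    then have br: "b r * r > 2" by simp
    then have b0: "b r > 0" using rp0 by (smt (verit) mult_nonpos_nonneg)
    show ?thesis
    proof (cases "g2 r \<le> 0")
      case True
      have "b r * g2 r \<le> 0" using True b0 by (intro mult_nonneg_nonpos) auto
      moreover have "(1 / 2 + 2 * N / r^2) * g1 r \<le> 0" using s g1_neg[OF r] by (intro mult_nonneg_nonpos) auto
      moreover have "2 * N * g r / r^3 \<ge> 0" using g rp0 N_ge_1 by simp
      ultimately show ?thesis unfolding g3_alt[OF rp0] by simp
    next
      case False
      then have g2: "g2 r > 0" by simp
      show ?thesis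
      proof (cases "4 \<le> N")
        case True
        then show ?thesis using g3_nonpos_high_dim r g g2 br by simp
      next
        case False
        define r1 where "r1 = sqrt (2 * N + 4)"
        have r1: "r1 > 0" "r1^2 = 2 * N + 4" using N_ge_1 by (auto simp: r1_def)
        have "r1^2 < r^2" using br drift_times[OF rp0] r1 by simp
        then have r1r: "r1 < r" using rp0 by (simp add: power2_less_imp_less)
        have rmr1: "rm < r1"
        proof -
          have "rm^2 < r0^2" using rm_less_r0 rm_pos by (intro power_strict_mono) auto
          then show ?thesis using r0_sq r1 by (intro power2_less_imp_less[of rm r1]) auto
        qed
        have "g r1 > 0" using g_pos_left[of r1 r] rmr1 r1r r g by simp
        moreover have "g2 r1 > 0" using g2_pos_left[OF rmr1 _ r(2)] r1r g g2 by simp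
        ultimately show ?thesis using g2_nonpos_low_dim[of r1] r1 r1r r N_cases False by auto
      qed
    qed
  qed
qed

end

section \<open>Outward bias\<close>

context annular_nat
begin

lemma g2_antimono:
  assumes "rm < u" "u \<le> r" "r < rp" shows "g2 r \<le> g2 u"
proof -
  have "- g2 u \<le> - g2 r"
  proof (rule nondecreasing_if_deriv_nonneg[OF assms(2), where F = "\<lambda>u. - g2 u" and F' = "\<lambda>u. - g3 u"])
    show "continuous_on {u..r} (\<lambda>u. - g2 u)"
      using assms by (intro continuous_at_imp_continuous_on ballI DERIV_isCont[OF DERIV_minus[OF g2_deriv0]]) auto
  qed (use assms g3_nonpos in \<open>auto intro!: DERIV_minus g2_deriv0\<close>)
  then show ?thesis by simp
qed

text \<open>Minus the derivative of the even part of f about c; it drives the equation of the odd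
  part as a source.\<close>

definition odd_slope :: "real \<Rightarrow> real" where
  "odd_slope s = (g (c - s) - g (c + s)) / 2"

definition odd_slope' :: "real \<Rightarrow> real" where
  "odd_slope' s = - (g1 (c - s) + g1 (c + s)) / 2"

lemma odd_slope_deriv0:
  assumes "0 \<le> s" "s < d" shows "(odd_slope has_real_derivative odd_slope' s) (at s)"
  unfolding odd_slope_def[abs_def] odd_slope'_def using mirror_in_open[OF assms]
  by (auto intro!: derivative_eq_intros simp: g1_def field_simps)

lemma odd_slope'_deriv0:
  assumes "0 \<le> s" "s < d" 
  shows "(odd_slope' has_real_derivative (g2 (c - s) - g2 (c + s)) / 2) (at s)"
  unfolding odd_slope'_def[abs_def] using mirror_in_open[OF assms]
  by (auto intro!: derivative_eq_intros simp: field_simps)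

lemma odd_slope_pos:
  assumes "0 < s" "s < d" shows "odd_slope s > 0"
proof -
  have "g (c + s) < g (c - s)"
  proof (rule decreasing_if_deriv_neg[where F = g and F' = g1])
    show "continuous_on {c - s..c + s} g"
      using mirror_in_open[of s] assms by (intro continuous_on_subset[OF g_cont]) auto
  qed (use mirror_in_open[of s] assms in \<open>auto intro!: g_deriv1 g1_neg\<close>)
  then show ?thesis by (simp add: odd_slope_def)
qed

text \<open>Since \<open>odd_slope\<close> is convex and vanishes at \<open>0\<close>, its quotient by \<open>s\<close> is nondecreasing.\<close>

lemma odd_slope_star:
  assumes "0 < s" "s < d" shows "odd_slope s \<le> s * odd_slope' s"
proof -
  have "0 * odd_slope' 0 - odd_slope 0 \<le> s * odd_slope' s - odd_slope s"
  proof (rule nondecreasing_if_deriv_nonneg[where F = "\<lambda>s. s * odd_slope' s - odd_slope s" 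
        and F' = "\<lambda>s. s * ((g2 (c - s) - g2 (c + s)) / 2)"])
    have der: "((\<lambda>s. s * odd_slope' s - odd_slope s) has_real_derivative x * ((g2 (c - x) - g2 (c + x)) / 2)) (at x)"
      if "0 \<le> x" "x \<le> s" for x
    proof -
      have "((\<lambda>s. s * odd_slope' s - odd_slope s) has_real_derivative 
          (1 * odd_slope' x + (g2 (c - x) - g2 (c + x)) / 2 * x) - odd_slope' x) (at x)"
        using that assms by (intro DERIV_diff DERIV_mult DERIV_ident odd_slope_deriv0 odd_slope'_deriv0) auto
      then show ?thesis by (rule DERIV_cong) (simp add: algebra_simps)
    qed
    show "continuous_on {0..s} (\<lambda>s. s * odd_slope' s - odd_slope s)"
      by (intro continuous_at_imp_continuous_on ballI DERIV_isCont[OF der]) auto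
    fix x assume x: "0 < x" "x < s"
    show "((\<lambda>s. s * odd_slope' s - odd_slope s) has_real_derivative x * ((g2 (c - x) - g2 (c + x)) / 2)) (at x)"
      using der x by simp
    show "0 \<le> x * ((g2 (c - x) - g2 (c + x)) / 2)"
      using x assms mirror_in_open[of x] g2_antimono[of "c - x" "c + x"] by simp
  qed (use assms in simp)
  then show ?thesis by (simp add: odd_slope_def)
qed

lemma odd_slope_ratio_mono:
  assumes "0 < s" "s \<le> t" "t < d" shows "odd_slope s / s \<le> odd_slope t / t"
proof (rule nondecreasing_if_deriv_nonneg[OF assms(2), where F = "\<lambda>s. odd_slope s / s" 
      and F' = "\<lambda>s. (odd_slope' s * s - odd_slope s * 1) / (s * s)"])
  have der: "((\<lambda>s. odd_slope s / s) has_real_derivative (odd_slope' x * x - odd_slope x * 1) / (x * x)) (at x)"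
    if "s \<le> x" "x \<le> t" for x
    using that assms by (intro DERIV_divide DERIV_ident odd_slope_deriv0) auto
  show "continuous_on {s..t} (\<lambda>s. odd_slope s / s)"
    by (intro continuous_at_imp_continuous_on ballI DERIV_isCont[OF der]) auto
  fix x assume x: "s < x" "x < t"
  show "((\<lambda>s. odd_slope s / s) has_real_derivative (odd_slope' x * x - odd_slope x * 1) / (x * x)) (at x)"
    using der x by simp
  show "0 \<le> (odd_slope' x * x - odd_slope x * 1) / (x * x)"
    using odd_slope_star[of x] x assms by (simp add: mult.commute)
qed

text \<open>The geometric mean of the mirrored weights has logarithmic derivative
  \<open>- odd_drift s\<close>, so it is the integrating factor for the odd part.\<close>

definition even_weight :: "real \<Rightarrow> real" where
  "even_weight s = sqrt (weight (c + s) * weight (c - s))"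

definition odd_drift :: "real \<Rightarrow> real" where
  "odd_drift s = (b (c + s) - b (c - s)) / 2"

lemma even_weight_pos: "0 \<le> s \<Longrightarrow> s \<le> d \<Longrightarrow> even_weight s > 0"
  using weight_mirror_pos[of s] by (simp add: even_weight_def)

lemma even_weight_cont: "continuous_on {0..d} even_weight"
  unfolding even_weight_def using d_less_c by (intro continuous_intros) auto

lemma even_weight_deriv0:
  assumes "0 \<le> s" "s \<le> d"
  shows "(even_weight has_real_derivative - odd_drift s * even_weight s) (at s)"
proof -
  define p where "p s = weight (c + s) * weight (c - s)" for s
  have pp: "p s > 0" using weight_mirror_pos[OF assms] by (simp add: p_def)
  have "(p has_real_derivative - 2 * odd_drift s * p s) (at s)"
    unfolding p_def[abs_def] odd_drift_def using assms d_less_c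
    by (auto intro!: derivative_eq_intros simp: field_simps)
  then have "((\<lambda>s. sqrt (p s)) has_real_derivative (inverse (sqrt (p s)) / 2) * (- 2 * odd_drift s * p s)) (at s)"
    by (rule DERIV_chain2[where f = sqrt and g = p, OF DERIV_real_sqrt[OF pp]])
  moreover have "(inverse (sqrt (p s)) / 2) * (- 2 * odd_drift s * p s) = - odd_drift s * sqrt (p s)"
    using pp real_sqrt_mult_self[of "p s"] by (simp add: field_simps)
  moreover have "even_weight = (\<lambda>s. sqrt (p s))" by (auto simp: even_weight_def p_def)
  ultimately show ?thesis by (simp only:)
qed

lemma mirror_square: "0 \<le> s \<Longrightarrow> s \<le> d \<Longrightarrow> c^2 - s^2 > 0"
  using d_less_c power_strict_mono[of s c 2] by simp

lemma odd_drift_eq: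
  assumes "0 \<le> s" "s \<le> d" shows "odd_drift s = s / 2 + N * s / (c^2 - s^2)"
proof -
  have nz: "c + s \<noteq> 0" "c - s \<noteq> 0" using assms d_less_c by auto
  have "c^2 - s^2 = (c + s) * (c - s)" by (simp add: power2_eq_square algebra_simps)
  then show ?thesis using nz unfolding odd_drift_def drift_def
    by (simp add: divide_simps) (simp add: algebra_simps)
qed

definition bias_kernel :: "real \<Rightarrow> real" where
  "bias_kernel s = even_weight s * exp (s^2 / 2) / (c^2 - s^2)"

lemma bias_kernel_pos: "0 \<le> s \<Longrightarrow> s \<le> d \<Longrightarrow> bias_kernel s > 0"
  using even_weight_pos mirror_square by (simp add: bias_kernel_def)

text \<open>The logarithmic derivative has the sign of D + 4 - s^2; this is where the width bound
  d^2 < 7/2 enters.\<close>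

lemma bias_kernel_increasing:
  assumes "0 < s" "s < t" "t < d" shows "bias_kernel s < bias_kernel t"
proof (rule increasing_if_deriv_pos[OF assms(2), where F = bias_kernel 
      and F' = "\<lambda>s. bias_kernel s * (s * (D + 4 - s^2) / (2 * (c^2 - s^2)))"])
  have der: "(bias_kernel has_real_derivative bias_kernel x * (x * (D + 4 - x^2) / (2 * (c^2 - x^2)))) (at x)"
    if "s \<le> x" "x \<le> t" for x
  proof -
    define q where "q = c^2 - x^2"
    have x: "0 \<le> x" "x \<le> d" "q > 0" using that assms mirror_square[of x] by (auto simp: q_def)
    have "((\<lambda>s. even_weight s * exp (s^2 / 2)) has_real_derivative 
        even_weight x * exp (x^2 / 2) * (x - odd_drift x)) (at x)"
      by (rule derivative_eq_intros even_weight_deriv0[OF x(1,2)] refl | simp)+ (simp add: algebra_simps)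
    moreover have "((\<lambda>s. c^2 - s^2) has_real_derivative - 2 * x) (at x)"
      by (auto intro!: derivative_eq_intros)
    ultimately have "(bias_kernel has_real_derivative 
      (even_weight x * exp (x^2 / 2) * (x - odd_drift x) * q - even_weight x * exp (x^2 / 2) * (- 2 * x)) / (q * q)) (at x)"
      unfolding bias_kernel_def[abs_def] using x(3) by (intro DERIV_divide[THEN DERIV_cong]) (auto simp: q_def)
    moreover have "(even_weight x * exp (x^2 / 2) * (x - odd_drift x) * q - even_weight x * exp (x^2 / 2) * (- 2 * x)) / (q * q)
       = bias_kernel x * (x - odd_drift x + 2 * x / q)"
      using x(3) by (simp add: bias_kernel_def q_def[symmetric] field_simps)
    moreover have "x - odd_drift x + 2 * x / q = x * (D + 4 - x^2) / (2 * q)"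
    proof -
      have od: "odd_drift x = x / 2 + N * x / q" using odd_drift_eq[OF x(1,2)] by (simp add: q_def)
      have Dq: "D + 4 - x^2 = q + 4 - 2 * N" by (simp add: D_def q_def)
      show ?thesis unfolding od Dq using x(3) by (simp add: field_simps)
    qed
    ultimately show ?thesis by (simp add: q_def)
  qed
  show "continuous_on {s..t} bias_kernel"
    by (intro continuous_at_imp_continuous_on ballI DERIV_isCont[OF der]) auto
  fix x assume x: "s < x" "x < t"
  show "(bias_kernel has_real_derivative bias_kernel x * (x * (D + 4 - x^2) / (2 * (c^2 - x^2)))) (at x)"
    using der x by simp
  have "x^2 \<le> d^2" using x assms by (intro power_mono) auto
  then have "D + 4 - x^2 > 0" using d_sq D_pos by simp
  then show "bias_kernel x * (x * (D + 4 - x^2) / (2 * (c^2 - x^2))) > 0"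
    using x assms bias_kernel_pos[of x] mirror_square[of x] by simp
qed

text \<open>The quotient of the weight that multiplies D - s^2 in \<open>bias_flux_deriv\<close> by
  the Gaussian weight s^2 exp(-s^2/2).\<close>

definition bias_ratio :: "real \<Rightarrow> real" where
  "bias_ratio s = c / 2 * (bias_kernel s * (odd_slope s / s))"

lemma bias_ratio_pos: "0 < s \<Longrightarrow> s < d \<Longrightarrow> bias_ratio s > 0"
  using bias_kernel_pos[of s] odd_slope_pos[of s] d_less_c d_pos by (simp add: bias_ratio_def)

lemma bias_ratio_increasing:
  assumes "0 < s" "s < t" "t < d" shows "bias_ratio s < bias_ratio t"
proof -
  have "bias_kernel s * (odd_slope s / s) < bias_kernel t * (odd_slope t / t)"
    using assms bias_kernel_increasing[OF assms] odd_slope_ratio_mono[of s t] odd_slope_pos[of s] bias_kernel_pos[of s]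
    by (intro mult_less_le_imp_less) auto
  then show ?thesis unfolding bias_ratio_def
    by (rule mult_strict_left_mono) (use d_less_c d_pos in simp)
qed

text \<open>The weighted Wronskian of the odd part of f with the test function s.\<close>

definition bias_flux :: "real \<Rightarrow> real" where
  "bias_flux s = even_weight s * (s * ((g (c + s) + g (c - s)) / 2) - (f (c + s) - f (c - s)) / 2)"

text \<open>The function s solves the homogeneous odd equation up to the residual N s / (c^2 - s^2),
  which gives the first term; the source gives the second.\<close>

lemma bias_flux_deriv:
  assumes "0 < s" "s < d"
  shows "(bias_flux has_real_derivative even_weight s * ((f (c + s) - f (c - s)) / 2) * (N * s / (c^2 - s^2))
    - bias_ratio s * (s^2 * exp (- (s^2) / 2) * (D - s^2))) (at s)"
proof -
  have m: "rm < c - s" "c - s < rp" "rm < c + s" "c + s < rp" using mirror_in_open[of s] assms by auto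
  have s: "0 \<le> s" "s \<le> d" using assms by auto
  define q where "q = c^2 - s^2"
  have q: "q > 0" using mirror_square[OF s] by (simp add: q_def)
  define w where "w = (f (c + s) - f (c - s)) / 2"
  define w' where "w' = (g (c + s) + g (c - s)) / 2"
  define bs where "bs = (b (c - s) + b (c + s)) / 2"
  have "((\<lambda>s. s * ((g (c + s) + g (c - s)) / 2) - (f (c + s) - f (c - s)) / 2) has_real_derivative
      s * ((g1 (c + s) - g1 (c - s)) / 2)) (at s)"
    using m by (auto intro!: derivative_eq_intros simp: g1_def field_simps)
  from DERIV_mult[OF even_weight_deriv0[OF s] this]
  have d0: "(bias_flux has_real_derivative even_weight s * (- odd_drift s * (s * w' - w) + s * ((g1 (c + s) - g1 (c - s)) / 2))) (at s)"
    unfolding bias_flux_def[abs_def] by (rule DERIV_cong) (simp add: w_def w'_def algebra_simps)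
  have g1_diff: "(g1 (c + s) - g1 (c - s)) / 2 = odd_drift s * w' - bs * odd_slope s - w / 2"
    by (simp add: g1_def odd_drift_def bs_def odd_slope_def w_def w'_def field_simps)
  have d1: "(bias_flux has_real_derivative even_weight s * (w * (odd_drift s - s / 2) - s * bs * odd_slope s)) (at s)"
    using d0 unfolding g1_diff by (rule DERIV_cong) (simp add: algebra_simps)
  have source: "even_weight s * (s * bs * odd_slope s) = bias_ratio s * (s^2 * exp (- (s^2) / 2) * (D - s^2))"
  proof -
    have bs: "bs = c * (D - s^2) / (2 * q)" using drift_sum_c[of s] assms by (simp add: bs_def q_def)
    have "exp (s^2 / 2) * exp (- (s^2) / 2) = 1" by (simp add: mult_exp_exp)
    then have "c / 2 * (even_weight s * (exp (s^2 / 2) * exp (- (s^2) / 2)) / q * (odd_slope s / s)) * (s^2 * (D - s^2))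
      = even_weight s * (s * bs * odd_slope s)"
      unfolding bs using q assms by (simp add: field_simps power2_eq_square)
    then show ?thesis unfolding bias_ratio_def bias_kernel_def q_def[symmetric] by (simp add: mult_ac)
  qed
  have od: "odd_drift s - s / 2 = N * s / (c^2 - s^2)" using odd_drift_eq[OF s] by simp
  have "even_weight s * (w * (odd_drift s - s / 2) - s * bs * odd_slope s) 
      = even_weight s * w * (N * s / (c^2 - s^2)) - bias_ratio s * (s^2 * exp (- (s^2) / 2) * (D - s^2))"
    unfolding od right_diff_distrib source by (simp only: mult.assoc)
  with d1 show ?thesis by (simp only: w_def)
qed

lemma bias_flux_cont: "continuous_on {0..d} bias_flux"
  unfolding bias_flux_def using mirror_in by (intro continuous_intros even_weight_cont) auto

lemma outward_bias:
  "integral {0..d} (\<lambda>s. s^4 * exp (- (s^2) / 2)) / integral {0..d} (\<lambda>s. s^2 * exp (- (s^2) / 2)) < D"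
proof -
  define h where "h s = s^2 * exp (- (s^2) / 2) * (D - s^2)" for s :: real
  \<comment> \<open>Chebyshev's inequality by freezing the increasing quotient at
    \<open>sqrt D\<close>, the sign change of D - s^2: then (R - bias_ratio s) (D - s^2) is positive
    away from that point.\<close>
  define R where "R = bias_ratio (sqrt D)"
  define M where "M s = bias_flux s + R * integral {0..s} h" for s
  have hc: "continuous_on S h" for S unfolding h_def by (intro continuous_intros) auto
  have int_deriv: "((\<lambda>s. integral {0..s} h) has_real_derivative h s) (at s)" if "0 < s" "s < d" for s
    using integral_has_real_derivative[OF hc, of s 0 d] that by (simp add: at_within_Icc_at)
  have int_cont: "continuous_on {0..d} (\<lambda>s. integral {0..s} h)"
    using indefinite_integral_continuous_1[OF integrable_continuous_interval[OF hc], of 0 d] .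
  have Mc: "continuous_on {0..d} M" unfolding M_def 
    by (intro continuous_intros bias_flux_cont int_cont)
  define M' where "M' s = even_weight s * ((f (c + s) - f (c - s)) / 2) * (N * s / (c^2 - s^2))
      + (R - bias_ratio s) * h s" for s
  have Md: "(M has_real_derivative M' s) (at s)" if "0 < s" "s < d" for s
    unfolding M_def[abs_def] M'_def using that
    by (intro DERIV_cong[OF DERIV_add[OF bias_flux_deriv DERIV_cmult[OF int_deriv]]]) (auto simp: h_def algebra_simps)
  have first: "even_weight s * ((f (c + s) - f (c - s)) / 2) * (N * s / (c^2 - s^2)) \<ge> 0" if "0 < s" "s < d" for s
    using that even_weight_pos[of s] f_mirror_le[of s] mirror_square[of s] N_ge_1 
    by (intro mult_nonneg_nonneg divide_nonneg_nonneg) auto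
  have M'_pos: "M' s > 0" if s: "0 < s" "s < d" "s \<noteq> sqrt D" for s
  proof -
    have e: "s^2 * exp (- (s^2) / 2) > 0" using s by simp
    have "(R - bias_ratio s) * (D - s^2) > 0"
    proof (cases "s < sqrt D")
      case True
      then have "s^2 < (sqrt D)^2" using s by (intro power_strict_mono) auto
      then show ?thesis using bias_ratio_increasing[OF s(1) True sqrt_D(2)] D_pos
        by (intro mult_pos_pos) (auto simp: R_def)
    next
      case False
      then have "sqrt D < s" using s by simp
      moreover from this have "(sqrt D)^2 < s^2" using sqrt_D by (intro power_strict_mono) auto
      ultimately show ?thesis using bias_ratio_increasing[OF sqrt_D(1) _ s(2)] D_pos
        by (intro mult_neg_neg) (auto simp: R_def)
    qed
    then have "(s^2 * exp (- (s^2) / 2)) * ((R - bias_ratio s) * (D - s^2)) > 0" by (rule mult_pos_pos[OF e])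
    then have "(R - bias_ratio s) * h s > 0" by (simp add: h_def mult_ac)
    then show ?thesis using first[of s] s by (simp add: M'_def)
  qed
  have "M 0 < M (sqrt D)"
    by (rule increasing_if_deriv_pos[OF sqrt_D(1), where F' = M'])
      (use sqrt_D Md M'_pos in \<open>auto intro!: continuous_on_subset[OF Mc]\<close>)
  also have "\<dots> < M d"
    by (rule increasing_if_deriv_pos[OF sqrt_D(2), where F' = M'])
      (use sqrt_D less_trans[OF sqrt_D(1)] order_trans[OF less_imp_le[OF sqrt_D(1)]] Md M'_pos in \<open>auto intro!: continuous_on_subset[OF Mc]\<close>)
  finally have "M 0 < M d" .
  moreover have "M 0 = 0" by (simp add: M_def bias_flux_def)
  \<comment> \<open>\<open>bias_flux\<close> vanishes at \<open>d\<close> because f vanishes and the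
    boundary slopes 1 and -1 cancel.\<close>
  moreover have "M d = R * integral {0..d} h"
    by (simp add: M_def bias_flux_def c_minus_d c_plus_d f_rm f_rp g_rm g_rp)
  moreover have "R > 0" unfolding R_def using bias_ratio_pos sqrt_D by simp
  ultimately have "integral {0..d} h > 0" by (simp add: zero_less_mult_iff)
  moreover have "integral {0..d} h = D * integral {0..d} (\<lambda>s. s^2 * exp (- (s^2) / 2)) 
      - integral {0..d} (\<lambda>s. s^4 * exp (- (s^2) / 2))"
  proof -
    have i: "(\<lambda>s. s^k * exp (- (s^2) / 2)) integrable_on {0..d}" for k :: nat
      by (intro integrable_continuous_interval continuous_intros) auto
    have "h = (\<lambda>s. D * (s^2 * exp (- (s^2) / 2)) - s^4 * exp (- (s^2) / 2))"
      by (auto simp: h_def algebra_simps power4_eq_xxxx power2_eq_square)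
    then have "integral {0..d} h = integral {0..d} (\<lambda>s. D * (s^2 * exp (- (s^2) / 2))) 
        - integral {0..d} (\<lambda>s. s^4 * exp (- (s^2) / 2))"
      using integral_diff[OF integrable_on_mult_right[OF i[of 2]] i[of 4], of D] by (simp only:)
    then show ?thesis by (simp only: integral_mult_right)
  qed
  moreover have "integral {0..d} (\<lambda>s. s^2 * exp (- (s^2) / 2)) > 0"
  proof -
    have c2: "continuous_on S (\<lambda>s::real. s^2 * exp (- (s^2) / 2))" for S by (intro continuous_intros) auto
    have "integral {0..0} (\<lambda>s. s^2 * exp (- (s^2) / 2)) < integral {0..d} (\<lambda>s. s^2 * exp (- (s^2) / 2))"
    proof (rule increasing_if_deriv_pos[OF d_pos, where F = "\<lambda>t. integral {0..t} (\<lambda>s. s^2 * exp (- (s^2) / 2))"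
          and F' = "\<lambda>s. s^2 * exp (- (s^2) / 2)"])
      show "continuous_on {0..d} (\<lambda>t. integral {0..t} (\<lambda>s::real. s^2 * exp (- (s^2) / 2)))"
        using indefinite_integral_continuous_1[OF integrable_continuous_interval[OF c2], of 0 d] .
      fix x assume x: "0 < x" "x < d"
      show "((\<lambda>t. integral {0..t} (\<lambda>s. s^2 * exp (- (s^2) / 2))) has_real_derivative x^2 * exp (- (x^2) / 2)) (at x)"
        using integral_has_real_derivative[OF c2, of x 0 d] x by (simp add: at_within_Icc_at)
    qed auto
    then show ?thesis by simp
  qed
  ultimately show ?thesis by (simp add: divide_less_eq)
qed

end

section \<open>Squared radii and asymptotics\<close>

lemma two_div_sqrt_two_mult: "2 * y / (sqrt 2 * x) = sqrt 2 * (y / x)" for x y :: real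
proof -
  have "2 * y / (sqrt 2 * x) = (2 / sqrt 2) * (y / x)" by simp
  then show ?thesis by (simp only: real_div_sqrt)
qed

context annular_nat
begin

lemma r0_bounds_scaled:
  assumes "M = sqrt N" shows "r0 = sqrt 2 * M" "2 * (M - \<kappa>)^2 = (r0 - scaled_kappa)^2" 
    "2 * (M + \<kappa>)^2 = (r0 + scaled_kappa)^2"
proof -
  show r: "r0 = sqrt 2 * M" using assms by (simp add: r0_def real_sqrt_mult)
  show "2 * (M - \<kappa>)^2 = (r0 - scaled_kappa)^2" "2 * (M + \<kappa>)^2 = (r0 + scaled_kappa)^2"
    unfolding r scaled_kappa_def distrib_left[symmetric] right_diff_distrib[symmetric] power_mult_distrib by simp_all
qed

lemma rp_sq_lower: "2 * (sqrt N + \<kappa>)^2 < rp^2"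
  unfolding r0_bounds_scaled(3)[OF refl] 
  using rp_lower r0_pos scaled_kappa_bounds by (intro power_strict_mono) auto

lemma rm_sq_upper: "rm^2 < 2 * (N / (sqrt N + \<kappa>))^2"
proof -
  have "r0^2 / (r0 + scaled_kappa) = sqrt 2 * (N / (sqrt N + \<kappa>))"
    unfolding r0_sq unfolding r0_bounds_scaled(1)[OF refl] scaled_kappa_def distrib_left[symmetric]
    by (rule two_div_sqrt_two_mult)
  then have "rm < sqrt 2 * (N / (sqrt N + \<kappa>))" using rm_upper by simp
  then have "rm^2 < (sqrt 2 * (N / (sqrt N + \<kappa>)))^2" using rm_pos by (intro power_strict_mono) auto
  then show ?thesis by (simp only: power_mult_distrib) simp
qed

text \<open>It fails for N = 1, where \<open>r0\<close> is sqrt 2; hence the two bounds of (i) that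
  are restricted to n >= 3.\<close>

lemma scaled_kappa_less_r0:
  assumes "2 \<le> N" shows "scaled_kappa < r0"
proof -
  have "2 \<le> r0" by (rule r0_lower) (use assms in simp)
  then show ?thesis using scaled_kappa_bounds by simp
qed

lemma rm_sq_lower:
  assumes "2 \<le> N" shows "2 * (sqrt N - \<kappa>)^2 < rm^2"
  unfolding r0_bounds_scaled(2)[OF refl] 
  using rm_lower scaled_kappa_less_r0[OF assms] by (intro power_strict_mono) auto

lemma rp_sq_upper:
  assumes "2 \<le> N" shows "rp^2 < 2 * (N / (sqrt N - \<kappa>))^2"
proof -
  have "r0^2 / (r0 - scaled_kappa) = sqrt 2 * (N / (sqrt N - \<kappa>))"
    unfolding r0_sq unfolding r0_bounds_scaled(1)[OF refl] scaled_kappa_def right_diff_distrib[symmetric]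
    by (rule two_div_sqrt_two_mult)
  then have "rp < sqrt 2 * (N / (sqrt N - \<kappa>))" using rp_upper scaled_kappa_less_r0[OF assms] by simp
  then have "rp^2 < (sqrt 2 * (N / (sqrt N - \<kappa>)))^2" using rm_pos rm_less_rp by (intro power_strict_mono) auto
  then show ?thesis by (simp only: power_mult_distrib) simp
qed

text \<open>Division with remainder: r0^2 / (r0 + k) = r0 - k + k^2 / (r0 + k) with k =
  \<open>scaled_kappa\<close>, so upper and lower bound differ by O(1/r0). For \<open>rp\<close> the
  denominator is r0 - k, kept above r0/2 by assumption.\<close>

lemma rm_asymptotic: "\<bar>rm - (r0 - scaled_kappa)\<bar> \<le> scaled_kappa^2 / r0"
proof -
  have k: "scaled_kappa > 0" using scaled_kappa_bounds by simp
  have "r0^2 / (r0 + scaled_kappa) = r0 - scaled_kappa + scaled_kappa^2 / (r0 + scaled_kappa)"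
    using k r0_pos by (simp add: field_simps power2_eq_square)
  also have "scaled_kappa^2 / (r0 + scaled_kappa) \<le> scaled_kappa^2 / r0"
    using k r0_pos by (intro divide_left_mono) auto
  finally show ?thesis using rm_upper rm_lower by simp
qed

lemma rp_asymptotic: 
  assumes "2 * scaled_kappa \<le> r0"
  shows "\<bar>rp - (r0 + scaled_kappa)\<bar> \<le> 2 * scaled_kappa^2 / r0"
proof -
  have k: "scaled_kappa > 0" using scaled_kappa_bounds by simp
  have "r0^2 / (r0 - scaled_kappa) = r0 + scaled_kappa + scaled_kappa^2 / (r0 - scaled_kappa)"
    using k assms by (simp add: field_simps power2_eq_square)
  also have "scaled_kappa^2 / (r0 - scaled_kappa) \<le> scaled_kappa^2 / (r0 / 2)"
    using k assms r0_pos by (intro divide_left_mono mult_pos_pos) auto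
  finally show ?thesis using rp_upper rp_lower assms k by (simp add: mult.commute)
qed

end

section \<open>Transfer to annular profiles and the final estimates\<close>

lemma annular_nat_if_profile:
  assumes "n \<ge> 2" "annular_profile n rm rp \<phi>"
  obtains g where "annular_nat (real n - 1) rm rp \<phi> g"
proof -
  from assms(2) obtain g g' where p: "0 < rm" "rm < rp"
    "\<And>r. r \<in> {rm..rp} \<Longrightarrow> (\<phi> has_real_derivative g r) (at r within {rm..rp})"
    "continuous_on {rm..rp} g"
    "\<And>r. r \<in> {rm<..<rp} \<Longrightarrow> (g has_real_derivative g' r) (at r)"
    "\<And>r. r \<in> {rm<..<rp} \<Longrightarrow> \<phi> r > 0"
    "\<phi> rm = 0" "\<phi> rp = 0" "g rm = 1" "g rp = -1"
    "\<And>r. r \<in> {rm<..<rp} \<Longrightarrow> g' r + ((real n - 1) / r - r / 2) * g r + (1 / 2) * \<phi> r = 0"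
    unfolding annular_profile_def by blast
  have "annular_nat (real n - 1) rm rp \<phi> g"
  proof
    show "1 \<le> real n - 1" using assms(1) by simp
    show "real n - 1 \<in> \<nat>" using assms(1) of_nat_in_Nats[of "n - 1", where 'a = real] by (simp add: of_nat_diff)
    fix r assume r: "rm < r" "r < rp"
    have "g' r = drift (real n - 1) r * g r - \<phi> r / 2"
      using p(11)[of r] r by (simp add: drift_def algebra_simps)
    then show "(g has_real_derivative drift (real n - 1) r * g r - \<phi> r / 2) (at r)"
      using p(5)[of r] r by simp
  qed (use p in auto)
  then show ?thesis by (rule that)
qed

lemma radius_bigo:
  fixes r :: "nat \<Rightarrow> real"
  assumes "\<And>n. n \<ge> n0 \<Longrightarrow> n0 \<ge> 2 \<Longrightarrow> \<bar>r n\<bar> \<le> C / sqrt (2 * (real n - 1))" "n0 \<ge> 2" "C \<ge> 0"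
  shows "r \<in> O(\<lambda>n. real n powr (-1/2))"
proof (rule bigoI[where c = C])
  show "\<forall>\<^sub>F n in sequentially. norm (r n) \<le> C * norm (real n powr (-1/2))"
    using eventually_ge_at_top[of n0]
  proof eventually_elim
    case (elim n)
    have n: "n \<ge> 2" using elim assms(2) by simp
    have "\<bar>r n\<bar> \<le> C / sqrt (2 * (real n - 1))" using assms elim by simp
    \<comment> \<open>For n >= 2, 2 (n - 1) >= n.\<close>
    also have "\<dots> \<le> C / sqrt (real n)"
      using n assms(3) by (intro divide_left_mono) auto
    also have "\<dots> = C * real n powr (-1/2)"
      using n by (simp add: powr_minus_divide powr_half_sqrt)
    finally show ?case by simp
  qed
qed

lemma profile_bounds:
  assumes n: "n \<ge> 2" and prof: "annular_profile n rm rp \<phi>"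
  shows "n \<ge> 3 \<longrightarrow>
         2 * (sqrt (real n - 1) - \<kappa>)^2 < rm^2 \<and>
         rm^2 < 2 * ((real n - 1) / (sqrt (real n - 1) + \<kappa>))^2 \<and>
         2 * (sqrt (real n - 1) + \<kappa>)^2 < rp^2 \<and>
         rp^2 < 2 * ((real n - 1) / (sqrt (real n - 1) - \<kappa>))^2" (is ?A)
    and "n = 2 \<longrightarrow> rm^2 < 2 / (1 + \<kappa>)^2 \<and> rp^2 > 2 * (1 + \<kappa>)^2" (is ?B)
    and "rp - rm < sqrt 14 \<and> rm * rp < 2 * (real n - 1)" (is ?C)
    and "let \<delta> = (rp - rm) / 2 in
         integral {0..\<delta>} (\<lambda>s. s^4 * exp (- (s^2) / 2)) /
           integral {0..\<delta>} (\<lambda>s. s^2 * exp (- (s^2) / 2))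
           < ((rm + rp) / 2)^2 - 2 * (real n - 1) \<and>
         ((rm + rp) / 2)^2 - 2 * (real n - 1) < \<delta>^2" (is ?E)
    and "\<bar>rm - (sqrt (2 * (real n - 1)) - sqrt 2 * \<kappa>)\<bar> \<le> (sqrt 2 * \<kappa>)^2 / sqrt (2 * (real n - 1))" (is ?F)
    and "n \<ge> 8 \<Longrightarrow> \<bar>rp - (sqrt (2 * (real n - 1)) + sqrt 2 * \<kappa>)\<bar> 
       \<le> 2 * (sqrt 2 * \<kappa>)^2 / sqrt (2 * (real n - 1))"
proof -
  obtain g where "annular_nat (real n - 1) rm rp \<phi> g" using annular_nat_if_profile[OF n prof] .
  then interpret annular_nat "real n - 1" rm rp \<phi> g .
  show ?A using rm_sq_lower rm_sq_upper rp_sq_lower rp_sq_upper by auto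
  show ?B using rm_sq_upper rp_sq_lower by (auto simp: power_divide)
  show ?C using width_less N_cases rm_rp_less by auto
  show ?E using outward_bias D_less unfolding Let_def D_def c_def d_def by simp
  show ?F using rm_asymptotic unfolding r0_def scaled_kappa_def .
  assume "n \<ge> 8"
  \<comment> \<open>The left side is below 10.82 and the right side is at least 14.\<close>
  then have "(2 * scaled_kappa)^2 \<le> 2 * (real n - 1)"
    using scaled_kappa_bounds power_mono[of "2 * scaled_kappa" "3288 / 1000" 2] by (simp add: power_divide)
  then have "2 * scaled_kappa \<le> r0" by (rule r0_lower)
  then show "\<bar>rp - (sqrt (2 * (real n - 1)) + sqrt 2 * \<kappa>)\<bar> \<le> 2 * (sqrt 2 * \<kappa>)^2 / sqrt (2 * (real n - 1))"
    using rp_asymptotic unfolding r0_def scaled_kappa_def by simp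
qed

theorem theorem1p4:
  shows
  "(1.1623 \<le> \<kappa> \<and> \<kappa> < 1.1624) \<and>
   (\<forall>(n::nat) (rm::real) (rp::real) (\<phi>::real \<Rightarrow> real).
      n \<ge> 2 \<and> annular_profile n rm rp \<phi> \<longrightarrow>
      (n \<ge> 3 \<longrightarrow>
         2 * (sqrt (real n - 1) - \<kappa>)^2 < rm^2 \<and>
         rm^2 < 2 * ((real n - 1) / (sqrt (real n - 1) + \<kappa>))^2 \<and>
         2 * (sqrt (real n - 1) + \<kappa>)^2 < rp^2 \<and>
         rp^2 < 2 * ((real n - 1) / (sqrt (real n - 1) - \<kappa>))^2) \<and>
      (n = 2 \<longrightarrow> rm^2 < 2 / (1 + \<kappa>)^2 \<and> rp^2 > 2 * (1 + \<kappa>)^2) \<and>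
      (rp - rm < sqrt 14 \<and> rm * rp < 2 * (real n - 1)) \<and>
      (let \<delta> = (rp - rm) / 2 in
         integral {0..\<delta>} (\<lambda>s. s^4 * exp (- (s^2) / 2)) /
           integral {0..\<delta>} (\<lambda>s. s^2 * exp (- (s^2) / 2))
           < ((rm + rp) / 2)^2 - 2 * (real n - 1) \<and>
         ((rm + rp) / 2)^2 - 2 * (real n - 1) < \<delta>^2)) \<and>
   (\<forall>(rm::nat \<Rightarrow> real) (rp::nat \<Rightarrow> real) (\<phi>::nat \<Rightarrow> real \<Rightarrow> real).
      (\<forall>n\<ge>2. annular_profile n (rm n) (rp n) (\<phi> n)) \<longrightarrow>
      (\<lambda>n. rm n - (sqrt (2 * (real n - 1)) - sqrt 2 * \<kappa>)) \<in> O(\<lambda>n. real n powr (-1/2)) \<and>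
      (\<lambda>n. rp n - (sqrt (2 * (real n - 1)) + sqrt 2 * \<kappa>)) \<in> O(\<lambda>n. real n powr (-1/2)))"
proof (intro conjI allI impI)
  show "1.1623 \<le> \<kappa>" "\<kappa> < 1.1624" by (rule kappa_bounds)+
next
  fix n :: nat and rm rp :: real and \<phi> :: "real \<Rightarrow> real"
  assume "n \<ge> 2 \<and> annular_profile n rm rp \<phi>"
  then have "n \<ge> 2" "annular_profile n rm rp \<phi>" by auto
  note b = profile_bounds[OF this]
  show "rp - rm < sqrt 14" "rm * rp < 2 * (real n - 1)" using b(3) by auto
  show "let \<delta> = (rp - rm) / 2 in
         integral {0..\<delta>} (\<lambda>s. s^4 * exp (- (s^2) / 2)) /
           integral {0..\<delta>} (\<lambda>s. s^2 * exp (- (s^2) / 2))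
           < ((rm + rp) / 2)^2 - 2 * (real n - 1) \<and>
         ((rm + rp) / 2)^2 - 2 * (real n - 1) < \<delta>^2" by (rule b(4))
  {
    assume "n \<ge> 3"
    then show "2 * (sqrt (real n - 1) - \<kappa>)^2 < rm^2"
      "rm^2 < 2 * ((real n - 1) / (sqrt (real n - 1) + \<kappa>))^2"
      "2 * (sqrt (real n - 1) + \<kappa>)^2 < rp^2"
      "rp^2 < 2 * ((real n - 1) / (sqrt (real n - 1) - \<kappa>))^2" using b(1) by auto
  }
  {
    assume "n = 2"
    then show "rm^2 < 2 / (1 + \<kappa>)^2" "rp^2 > 2 * (1 + \<kappa>)^2" using b(2) by auto
  }
next
  fix rm rp :: "nat \<Rightarrow> real" and \<phi> :: "nat \<Rightarrow> real \<Rightarrow> real"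
  assume "\<forall>n\<ge>2. annular_profile n (rm n) (rp n) (\<phi> n)"
  then have prof: "annular_profile n (rm n) (rp n) (\<phi> n)" if "n \<ge> 2" for n using that by blast
  show "(\<lambda>n. rm n - (sqrt (2 * (real n - 1)) - sqrt 2 * \<kappa>)) \<in> O(\<lambda>n. real n powr (-1/2))"
    by (rule radius_bigo[OF profile_bounds(5)[OF _ prof], of 2]) auto
  show "(\<lambda>n. rp n - (sqrt (2 * (real n - 1)) + sqrt 2 * \<kappa>)) \<in> O(\<lambda>n. real n powr (-1/2))"
    by (rule radius_bigo[OF profile_bounds(6)[OF _ prof], of 8]) auto
qed

end
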